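(* Let $n,a,b$ be positive integers, let $f:[0,a]\to[1,b+1]$ be a weakly increasing function, and let $$L=\{(x,y): x\in[0,a]\text{ and }0\le y<f(x)\}$$ be the associated upper ladder region. For convenience, extend $f$ to all negative integers by $f(x):=f(0)$ for $x<0$. Let $A^{(i)}=(A^{(i)}_1,A^{(i)}_2)$ and $E^{(i)}=(E^{(i)}_1,E^{(i)}_2)$, $i=1,2,\dots,n$, be lattice points in the region $L$ satisfying $$f(x)=f\big(A^{(1)}_1\big)\quad\text{for all }x\le A^{(1)}_1,$$ $$A^{(1)}_1\le A^{(2)}_1\le\dots\le A^{(n)}_1,\qquad A^{(1)}_2>A^{(2)}_2>\dots>A^{(n)}_2,$$ $$E^{(1)}_1<E^{(2)}_1<\dots<E^{(n)}_1,\qquad E^{(1)}_2\ge E^{(2)}_2\ge\dots\ge E^{(n)}_2.$$ Put $\tilde A^{(i)}=A^{(i)}+(-i+1,i)$ and $\tilde E^{(i)}=E^{(i)}+(-i,i-1)$ for $i=1,2,\dots,n$. Then $$\sum_{\mathbf P}z^{\mathrm{NE}(\mathbf P)}=\det_{1\le s,t\le n}\left(\ \sum_{T\in \mathrm{TA}(t-s;\tilde A^{(t)},\tilde E^{(s)};f,s-1)}z^{|T|/2}\right),$$ where the sum on the left-hand side is over all families $\mathbf P=(P_1,\dots,P_n)$ of nonintersecting lattice paths $P_i:A^{(i)}\to E^{(i)}$, $i=1,\dots,n$, lying in the region $L$. Explicitly, the sum in the $(s,t)$ entry of the determinant is over all two-rowed arrays $T$ of type $l=t-s$ whose first-row entries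 lie between $\alpha_1=A^{(t)}_1-t+1$ and $\varepsilon_1=E^{(s)}_1-s$, whose second-row entries lie between $\alpha_2=A^{(t)}_2+t$ and $\varepsilon_2=E^{(s)}_2+s-1$, and which satisfy $b_r<f(a_{r+d})$ with $d=s-1$ for all $r$ such that both $b_r$ and $a_{r+d}$ exist in the array.
   Context: For integers $c,d$, $[c,d]$ denotes the set of all integers $\ge c$ and $\le d$. The variable $z$ is formal (half-integral powers of $z$ are allowed). Lattice paths: a lattice path is a path in the plane integer lattice consisting of unit horizontal and vertical steps in the positive direction; $P:A\to E$ means that $P$ goes from $A$ to $E$. A family $(P_1,\dots,P_n)$ of lattice paths is nonintersecting if no two paths of the family have a point in common. A point of $P$ which is the end point of a vertical step and at the same time the starting point of a horizontal step of $P$ is a north-east turn (NE-turn) of $P$; $\mathrm{NE}(P)$ is the number of NE-turns of $P$, and $\mathrm{NE}(\mathbf P)=\sum_{i=1}^n\mathrm{NE}(P_i)$. (For upper ladder regions $L$ as considered here, a path is inside $L$ if and only if all of its NE-turns are.) Two-rowed arrays: a two-rowed array of type $l\in\mathbb Z$ consists, for some integer $k\ge\max(0,-l)$, of a strictly increasing first row of integers $a_{-l+1}<a_{-l+2}<\dots<a_k$ ($k+l$ entries, indexed by $-l+1,\dots,k$) and a strictly increasing second row of integers $b_1<b_2<\dots<b_k$ ($k$ entries). Rows may be empty. Its size $|T|$ is its total number of entries, $|T|=l+2k$. For pairs of integers $A=(\alpha_1,\alpha_2)$, $E=(\varepsilon_1,\varepsilon_2)$ and integers $l,d$, $\mathrm{TA}(l;A,E;f,d)$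 denotes the set of all two-rowed arrays of type $l$ such that all first-row entries are bounded below by $\alpha_1$ and above by $\varepsilon_1$, all second-row entries are bounded below by $\alpha_2$ and above by $\varepsilon_2$, and $b_s<f(a_{s+d})$ for all $s$ such that both $b_s$ and $a_{s+d}$ exist in the array.
   Formalization: The formal theorem additionally assumes that each A^(i) is componentwise at most E^(i); otherwise no path A^(i)→E^(i) exists, the left side is 0, but the determinant has constant term 1, so the identity fails. *)

theory Defs
  imports
    "HOL-Library.FuncSet"
    "HOL-Library.Disjoint_Sets"
    "HOL-Library.Product_Plus"
    "HOL-Library.Poly_Mapping"
    "Jordan_Normal_Form.Determinant"
begin

type_synonym point = "int \<times> int"

(* A formal variable z with fractional powers: the monoid algebra of the additive group of the
   rationals over the integers. Only exponents in (1/2)\<nat> occur below. *)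
type_synonym z_poly = "rat \<Rightarrow>\<^sub>0 int"

definition z_pow :: "rat \<Rightarrow> z_poly" where
  "z_pow q = Poly_Mapping.single q 1"

lemma z_pow_0: "z_pow 0 = 1"
  by (simp add: z_pow_def)

lemma z_pow_add: "z_pow (p + q) = z_pow p * z_pow q"
  by (simp add: z_pow_def mult_single)

definition horizontal_step :: "point \<Rightarrow> point \<Rightarrow> bool" where
  "horizontal_step p q \<longleftrightarrow> q = p + (1, 0)"

definition vertical_step :: "point \<Rightarrow> point \<Rightarrow> bool" where
  "vertical_step p q \<longleftrightarrow> q = p + (0, 1)"

(* A path is given by the list of its lattice points. A single point is a path without steps. *)
definition lattice_path :: "point list \<Rightarrow> bool" where
  "lattice_path P \<longleftrightarrow> P \<noteq> [] \<and> successively (\<lambda>p q. horizontal_step p q \<or> vertical_step p q) P"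

definition lattice_paths :: "point \<Rightarrow> point \<Rightarrow> point list set" where
  "lattice_paths A E = {P. lattice_path P \<and> hd P = A \<and> last P = E}"

definition NE_turns :: "point list \<Rightarrow> point set" where
  "NE_turns P = {P ! i | i. 0 < i \<and> Suc i < length P \<and>
     vertical_step (P ! (i - 1)) (P ! i) \<and> horizontal_step (P ! i) (P ! Suc i)}"

definition NE :: "point list \<Rightarrow> nat" where
  "NE P = card (NE_turns P)"

definition ladder_region :: "int \<Rightarrow> (int \<Rightarrow> int) \<Rightarrow> point set" where
  "ladder_region a f = {(x, y). x \<in> {0..a} \<and> 0 \<le> y \<and> y < f x}"

(* Families are functions on {1..n} that are undefined elsewhere, so that different elements of
   this set are different families. *)
definition nonintersecting_families ::
    "nat \<Rightarrow> (nat \<Rightarrow> point) \<Rightarrow> (nat \<Rightarrow> point) \<Rightarrow> point set \<Rightarrow> (nat \<Rightarrow> point list) set" where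
  "nonintersecting_families n A E L =
     {P \<in> (\<Pi>\<^sub>E i\<in>{1..n}. lattice_paths (A i) (E i)).
        (\<forall>i\<in>{1..n}. set (P i) \<subseteq> L) \<and> disjoint_family_on (\<lambda>i. set (P i)) {1..n}}"

definition NE_family :: "nat \<Rightarrow> (nat \<Rightarrow> point list) \<Rightarrow> nat" where
  "NE_family n P = (\<Sum>i=1..n. NE (P i))"

(* A two-rowed array is the pair (as, bs) of its rows, with k = length bs. In an array of type l
   the list as holds the entries with indices -l+1, ..., k and bs those with indices 1, ..., k. *)
type_synonym two_rowed_array = "int list \<times> int list"

definition array_of_type :: "int \<Rightarrow> two_rowed_array \<Rightarrow> bool" where
  "array_of_type l = (\<lambda>(as, bs). int (length as) = int (length bs) + l \<and>
     sorted_wrt (<) as \<and> sorted_wrt (<) bs)"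

definition array_size :: "two_rowed_array \<Rightarrow> nat" where
  "array_size = (\<lambda>(as, bs). length as + length bs)"

definition first_row :: "int \<Rightarrow> two_rowed_array \<Rightarrow> int \<Rightarrow> int" where
  "first_row l T i = fst T ! nat (i + l - 1)"

definition second_row :: "two_rowed_array \<Rightarrow> int \<Rightarrow> int" where
  "second_row T i = snd T ! nat (i - 1)"

definition TA :: "int \<Rightarrow> point \<Rightarrow> point \<Rightarrow> (int \<Rightarrow> int) \<Rightarrow> int \<Rightarrow> two_rowed_array set" where
  "TA l A E f d = {T. array_of_type l T \<and>
     set (fst T) \<subseteq> {fst A..fst E} \<and> set (snd T) \<subseteq> {snd A..snd E} \<and>
     (\<forall>s. s \<in> {1..int (length (snd T))} \<and> s + d \<in> {- l + 1..int (length (snd T))} \<longrightarrow>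
        second_row T s < f (first_row l T (s + d)))}"

(* Finiteness of the index sets of the sums: no sum degenerates to the default value 0. *)

lemma finite_TA: "finite (TA l A E f d)"
proof (rule finite_subset)
  show "TA l A E f d \<subseteq> {as. set as \<subseteq> {fst A..fst E} \<and> distinct as} \<times>
      {bs. set bs \<subseteq> {snd A..snd E} \<and> distinct bs}"
    by (auto simp: TA_def array_of_type_def strict_sorted_iff)
qed (simp add: finite_subset_distinct)

lemma lattice_path_distinct:
  assumes "lattice_path P"
  shows "distinct P"
proof -
  have "successively (\<lambda>p q. fst p + snd p < fst q + snd q) P"
    using assms unfolding lattice_path_def
    by (auto elim!: successively_mono simp: horizontal_step_def vertical_step_def)
  then have "sorted_wrt (\<lambda>p q. fst p + snd p < fst q + snd q) P"
    by (subst (asm) successively_conv_sorted_wrt) (auto intro: transpI)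
  then show ?thesis
    by (induction P) auto
qed

lemma finite_ladder_region: "finite (ladder_region a f)"
proof (rule finite_subset)
  show "ladder_region a f \<subseteq> (SIGMA x:{0..a}. {0..<f x})"
    by (auto simp: ladder_region_def)
qed simp

lemma finite_nonintersecting_families:
  assumes "finite L"
  shows "finite (nonintersecting_families n A E L)"
proof (rule finite_subset)
  show "nonintersecting_families n A E L \<subseteq> (\<Pi>\<^sub>E i\<in>{1..n}. {P. set P \<subseteq> L \<and> distinct P})"
    by (fastforce simp: nonintersecting_families_def lattice_paths_def PiE_iff extensional_def
        intro: lattice_path_distinct)
qed (simp add: finite_PiE finite_subset_distinct assms)

end

theory Submission
  imports Defs
begin

text \<open>
  The proof is a sign-reversing involution in the style of Lindstroem, Gessel and Viennot, carried
  out on two-rowed arrays instead of paths. Expanding the determinant gives a signed sum over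
  families in which, for a permutation \<open>\<sigma>\<close>, the \<open>i\<close>-th array has the start data of
  \<open>A (\<sigma> i)\<close> and the end data of \<open>E i\<close>. An array is kept as the pair of the sets of its entries,
  and is studied through its height at a point \<open>(x, z)\<close>, the start index minus the number of
  first-row entries left of \<open>x\<close> plus the number of second-row entries below \<open>z\<close>. The height
  runs from the start index to the end index. When the two agree, the array lists the NE-turns of
  a lattice path, moved along the antidiagonal, and the points of height at least \<open>i\<close> are, up to
  conventions at its ends, those weakly above this path.

  Two neighbouring arrays cross at a point if it is weakly above the \<open>i\<close>-th one and weakly below the
  next one. At the last crossing both heights are equal (\<open>extremal_crossing\<close>), hence the parts of
  both arrays in front of this point can be exchanged. This exchange multiplies \<open>\<sigma>\<close> by a
  transposition, keeps the total size, and does not move the last crossing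
  (\<open>swap_at_last_crossing\<close>), so all families with a crossing cancel.

  Three points need more than the usual argument. First, an array with different start and end
  index is no path, so that it is not evident that a nontrivial permutation enforces a crossing;
  this is \<open>crossing_if_not_id\<close>, based on \<open>early_start_bound\<close>. Secondly, the exchange must respect
  the ladder. In terms of heights the condition \<open>b\<^sub>r < f (a\<^sub>r\<^sub>+\<^sub>d)\<close> says that the height does not
  become negative along the boundary of the ladder (\<open>in_ladder\<close>); this form depends on the start
  index only, and it survives the exchange because behind the last crossing the first array shields
  all others from the boundary (\<open>last_crossing_in_ladder\<close>). Thirdly, the families without crossing
  have \<open>\<sigma> = id\<close> and have to be the nonintersecting families of paths in the region
  (\<open>bij_family_rows\<close>). Here the ladder conditions on the single arrays differ from those on the
  single paths, but without crossings both hold for the whole family as soon as they hold for its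
  first member, where they agree.

  Arrays are indexed from 0, that is, \<open>i = s - 1\<close> for the row \<open>s\<close> and \<open>u = t - 1\<close> for the
  column \<open>t\<close> of the matrix, while paths keep their indices \<open>1, \<dots>, n\<close>.
\<close>

section \<open>Counting the elements of a set below a bound\<close>

definition below :: "int set \<Rightarrow> int \<Rightarrow> int" where
  "below S x = int (card {a \<in> S. a < x})"

lemma below_nonneg: "0 \<le> below S x"
  by (simp add: below_def)

lemma below_mono: "finite S \<Longrightarrow> x \<le> y \<Longrightarrow> below S x \<le> below S y"
  unfolding below_def by (auto intro!: card_mono)

lemma below_plus_one: "finite S \<Longrightarrow> below S (x + 1) = below S x + of_bool (x \<in> S)"
proof -
  assume fin: "finite S"
  have "{a \<in> S. a < x + 1} = (if x \<in> S then insert x {a \<in> S. a < x} else {a \<in> S. a < x})"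
    by (auto simp: order_le_less)
  with fin show ?thesis by (simp add: below_def)
qed

lemma below_growth:
  assumes "finite S" "x \<le> y"
  shows "below S y \<le> below S x + (y - x)"
  using assms(2)
proof (induction y rule: int_ge_induct)
  case (step i)
  then show ?case using below_plus_one[OF assms(1), of i] by (auto simp: of_bool_def split: if_splits)
qed simp

lemma below_le_card: "finite S \<Longrightarrow> below S x \<le> int (card S)"
  unfolding below_def by (auto intro!: card_mono)

lemma below_eq_card: "S \<subseteq> {..<x} \<Longrightarrow> below S x = int (card S)"
  unfolding below_def by (auto intro!: arg_cong[where f = card])

lemma below_eq_0: "S \<subseteq> {x..} \<Longrightarrow> below S x = 0"
  unfolding below_def by (auto simp: card_eq_0_iff)

definition graft :: "int \<Rightarrow> int set \<Rightarrow> int set \<Rightarrow> int set" where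
  "graft x C D = {c \<in> C. c < x} \<union> {d \<in> D. x \<le> d}"

lemma finite_graft: "finite C \<Longrightarrow> finite D \<Longrightarrow> finite (graft x C D)"
  by (simp add: graft_def)

lemma graft_graft: "graft x (graft x C D) (graft x D C) = C"
  by (auto simp: graft_def)

lemma card_graft:
  assumes "finite C" "finite D"
  shows "int (card (graft x C D)) = below C x + int (card D) - below D x"
proof -
  have "card D = card {d \<in> D. d < x} + card {d \<in> D. x \<le> d}"
    using assms by (subst card_Un_disjoint[symmetric]) (auto intro!: arg_cong[where f = card])
  moreover have "card (graft x C D) = card {c \<in> C. c < x} + card {d \<in> D. x \<le> d}"
    unfolding graft_def using assms by (intro card_Un_disjoint) auto
  ultimately show ?thesis by (simp add: below_def)
qed

lemma below_graft:
  assumes "finite C" "finite D"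
  shows "below (graft x C D) y =
    (if y \<le> x then below C y else below C x + below D y - below D x)"
proof (cases "y \<le> x")
  case True
  then have "{a \<in> graft x C D. a < y} = {a \<in> C. a < y}" by (auto simp: graft_def)
  with True show ?thesis by (simp add: below_def)
next
  case False
  then have "{a \<in> graft x C D. a < y} = graft x C {d \<in> D. d < y}" by (auto simp: graft_def)
  then have "below (graft x C D) y = below C x + below D y - below {d \<in> D. d < y} x"
    using assms card_graft[of C "{d \<in> D. d < y}" x] by (simp add: below_def)
  moreover have "{a \<in> {d \<in> D. d < y}. a < x} = {d \<in> D. d < x}" using False by auto
  ultimately show ?thesis using False by (simp add: below_def)
qed

section \<open>Pairs of rows and their heights\<close>
type_synonym rows = "int set \<times> int set"

text \<open>The number \<open>u\<close> is the start index of the array. An array of type \<open>u - i\<close> has height \<open>i\<close> at all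
points behind its entries. If \<open>u = i = 0\<close> and a point \<open>(x, y)\<close> is in the columns of the lattice path
whose NE-turns form the array, and not below its start, then it lies weakly above this path if and
only if the height at \<open>(x, y + 1)\<close> is at least \<open>0\<close>. For \<open>u = i > 0\<close> the same holds with \<open>i\<close> in
place of \<open>0\<close> after a shift.\<close>
definition height :: "nat \<Rightarrow> rows \<Rightarrow> int \<Rightarrow> int \<Rightarrow> int" where
  "height u T x z = int u - below (fst T) x + below (snd T) z"

definition splice_rows :: "int \<Rightarrow> int \<Rightarrow> rows \<Rightarrow> rows \<Rightarrow> rows" where
  "splice_rows x z T U = (graft x (fst T) (fst U), graft z (snd T) (snd U))"

abbreviation finite_rows :: "rows \<Rightarrow> bool" where
  "finite_rows T \<equiv> finite (fst T) \<and> finite (snd T)"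

lemma splice_splice: "splice_rows x z (splice_rows x z T U) (splice_rows x z U T) = T"
  by (simp add: splice_rows_def graft_graft)

lemma finite_splice: "finite_rows T \<Longrightarrow> finite_rows U \<Longrightarrow> finite_rows (splice_rows x z T U)"
  by (simp add: splice_rows_def finite_graft)

lemma height_mono:
  assumes "finite_rows T" "x' \<le> x" "z \<le> z'"
  shows "height u T x z \<le> height u T x' z'"
  using below_mono[of "fst T" x' x] below_mono[of "snd T" z z'] assms by (simp add: height_def)

lemma height_splice_before:
  assumes "finite_rows T" "finite_rows U" "x \<le> X" "z \<le> Z"
  shows "height u (splice_rows X Z T U) x z = height u T x z"
  using assms by (simp add: height_def splice_rows_def below_graft)

text \<open>The height behind a point depends on the entries in front of it only through the height at the
point itself. So the beginnings of two arrays are interchangeable where their heights agree.\<close>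
lemma height_splice_after:
  assumes "finite_rows T" "finite_rows U" "X \<le> x" "Z \<le> z" "height u T X Z = height v U X Z"
  shows "height u (splice_rows X Z T U) x z = height v U x z"
  using assms by (auto simp: height_def splice_rows_def below_graft)

section \<open>Families of arrays and their crossings\<close>

text \<open>The entries of an array with start \<open>u\<close> and end \<open>i\<close> lie in \<open>{\<alpha> u..<\<epsilon> i}\<close> and
\<open>{\<beta> u..<\<delta> i}\<close>. These bounds come from points that have been moved along the antidiagonal by
their index; undoing this, the assumptions are the weak or strict monotonicity of the coordinates
of the points \<open>A\<close> and \<open>E\<close>. The function \<open>g\<close> is the boundary of the ladder, and its last two
properties say that the first start point and the first end point lie below it.\<close>
locale ladder_rows =
  fixes n :: nat and \<alpha> \<beta> \<epsilon> \<delta> :: "nat \<Rightarrow> int" and g :: "int \<Rightarrow> int"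
  assumes \<alpha>_step: "u \<le> v \<Longrightarrow> v < n \<Longrightarrow> \<alpha> u + int u \<le> \<alpha> v + int v"
    and \<beta>_antimono: "u \<le> v \<Longrightarrow> v < n \<Longrightarrow> \<beta> v \<le> \<beta> u"
    and \<epsilon>_mono: "i \<le> j \<Longrightarrow> j < n \<Longrightarrow> \<epsilon> i \<le> \<epsilon> j"
    and \<delta>_step: "i \<le> j \<Longrightarrow> j < n \<Longrightarrow> \<delta> j - int j \<le> \<delta> i - int i"
    and \<alpha>_le_\<epsilon>: "i < n \<Longrightarrow> \<alpha> i \<le> \<epsilon> i"
    and g_mono: "x \<le> y \<Longrightarrow> g x \<le> g y"
    and g_ge: "\<beta> 0 \<le> g x"
    and g_ge_end: "\<epsilon> 0 \<le> x \<Longrightarrow> \<delta> 0 \<le> g x"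
begin

definition arrays :: "nat \<Rightarrow> nat \<Rightarrow> rows set" where
  "arrays u i = {T. fst T \<subseteq> {\<alpha> u..<\<epsilon> i} \<and> snd T \<subseteq> {\<beta> u..<\<delta> i} \<and>
     card (fst T) + i = card (snd T) + u}"

text \<open>The condition \<open>b\<^sub>r < f (a\<^sub>r\<^sub>+\<^sub>d)\<close> with \<open>d = i\<close> pairs entries of the same index if indices are counted
from the start: in an array with start \<open>u\<close> the \<open>j\<close>-th entry of the second row is paired with the
\<open>(j + u)\<close>-th one of the first row. Hence it bounds the number of second-row entries below
\<open>g x\<close> from below by the number of first-row entries up to \<open>x\<close> minus \<open>u\<close>.\<close>
definition in_ladder :: "nat \<Rightarrow> rows \<Rightarrow> bool" where
  "in_ladder u T \<longleftrightarrow> (\<forall>x. 0 \<le> height u T (x + 1) (g x))"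

definition config :: "(nat \<Rightarrow> nat) \<Rightarrow> (nat \<Rightarrow> rows) \<Rightarrow> bool" where
  "config \<sigma> T \<longleftrightarrow> \<sigma> permutes {0..<n} \<and>
     (\<forall>i<n. T i \<in> arrays (\<sigma> i) i)"

text \<open>The bounds on \<open>x\<close> and \<open>z\<close> make sure that the entries in front of the point, if any, and those
behind it fit together when the starts are exchanged, and that the point is not beyond the
\<open>i\<close>-th end. An upper bound on \<open>z\<close> is implied. The heights are related to \<open>i\<close> by inequalities since
these can be transported from one point to another; equality is a property of the last crossing.\<close>
definition crossing :: "(nat \<Rightarrow> nat) \<Rightarrow> (nat \<Rightarrow> rows) \<Rightarrow> nat \<Rightarrow> int \<Rightarrow> int \<Rightarrow> bool" where
  "crossing \<sigma> T i x z \<longleftrightarrow> Suc i < n \<and>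
     \<alpha> (\<sigma> i) \<le> x \<and> \<alpha> (\<sigma> (Suc i)) \<le> x \<and> x \<le> \<epsilon> i \<and>
     \<beta> (\<sigma> i) \<le> z \<and> \<beta> (\<sigma> (Suc i)) \<le> z \<and>
     int i \<le> height (\<sigma> i) (T i) x z \<and> height (\<sigma> (Suc i)) (T (Suc i)) x z \<le> int i"

definition last_crossing :: "(nat \<Rightarrow> nat) \<Rightarrow> (nat \<Rightarrow> rows) \<Rightarrow> nat \<Rightarrow> int \<Rightarrow> int \<Rightarrow> bool" where
  "last_crossing \<sigma> T i x z \<longleftrightarrow> crossing \<sigma> T i x z \<and>
     (\<forall>j y w. crossing \<sigma> T j y w \<longrightarrow> y < x \<or> y = x \<and> (w < z \<or> w = z \<and> j \<le> i))"

lemma finite_rows_arrays: "T \<in> arrays u i \<Longrightarrow> finite_rows T"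
  unfolding arrays_def by (auto intro: finite_subset)

lemma height_at_end:
  assumes "T \<in> arrays u i" "\<delta> i \<le> z"
  shows "height u T x z = int i + (int (card (fst T)) - below (fst T) x)"
proof -
  have "below (snd T) z = int (card (snd T))"
    using assms by (intro below_eq_card) (auto simp: arrays_def)
  then show ?thesis using assms by (auto simp: height_def arrays_def)
qed

lemma height_right_end:
  assumes "T \<in> arrays u i" "\<epsilon> i \<le> x"
  shows "height u T x z = int i - (int (card (snd T)) - below (snd T) z)"
proof -
  have "below (fst T) x = int (card (fst T))"
    using assms by (intro below_eq_card) (auto simp: arrays_def)
  then show ?thesis using assms by (auto simp: height_def arrays_def)
qed

text \<open>At or above \<open>\<delta> (Suc i)\<close> all second-row entries of the array with index \<open>Suc i\<close> are counted, so
that its height is at least its end index.\<close>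
lemma crossing_z_bound:
  assumes "config \<sigma> T" "crossing \<sigma> T i x z"
  shows "z < \<delta> (Suc i)"
proof (rule ccontr)
  assume "\<not> z < \<delta> (Suc i)"
  moreover have arr: "T (Suc i) \<in> arrays (\<sigma> (Suc i)) (Suc i)"
    using assms by (auto simp: config_def crossing_def)
  ultimately have "height (\<sigma> (Suc i)) (T (Suc i)) x z \<ge> int (Suc i)"
    using height_at_end[OF arr, of z x] below_le_card[of "fst (T (Suc i))" x] finite_rows_arrays[OF arr]
    by simp
  with assms show False by (simp add: crossing_def)
qed

lemma finite_crossings:
  assumes "config \<sigma> T"
  shows "finite {(i, x, z). crossing \<sigma> T i x z}"
proof (rule finite_subset)
  show "{(i, x, z). crossing \<sigma> T i x z} \<subseteq>
      (SIGMA i:{..<n}. {\<alpha> (\<sigma> i)..\<epsilon> i} \<times> {\<beta> (\<sigma> i)..<\<delta> (Suc i)})"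
    using crossing_z_bound[OF assms] by (auto simp: crossing_def)
qed auto

lemma last_crossing_exists:
  assumes "config \<sigma> T" "crossing \<sigma> T i x z"
  obtains j y w where "last_crossing \<sigma> T j y w"
proof -
  let ?C = "{(i, x, z). crossing \<sigma> T i x z}"
  define X where "X = Max ((\<lambda>(i, x, z). x) ` ?C)"
  let ?D = "{c \<in> ?C. fst (snd c) = X}"
  define Z where "Z = Max ((\<lambda>(i, x, z). z) ` ?D)"
  let ?E = "{c \<in> ?D. snd (snd c) = Z}"
  define I where "I = Max (fst ` ?E)"
  note fin = finite_crossings[OF assms(1)]
  have "X \<in> (\<lambda>(i, x, z). x) ` ?C"
    unfolding X_def using fin assms(2) by (intro Max_in) auto
  moreover have X_max: "y \<le> X" if "crossing \<sigma> T j y w" for j y w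
    unfolding X_def using fin that by (intro Max_ge) force+
  ultimately have "Z \<in> (\<lambda>(i, x, z). z) ` ?D"
    unfolding Z_def using fin by (intro Max_in) (auto simp: image_iff)
  moreover have Z_max: "w \<le> Z" if "crossing \<sigma> T j X w" for j w
    unfolding Z_def using fin that by (intro Max_ge) force+
  ultimately have "I \<in> fst ` ?E"
    unfolding I_def using fin by (intro Max_in) (auto simp: image_iff)
  moreover have I_max: "j \<le> I" if "crossing \<sigma> T j X Z" for j
    unfolding I_def using fin that by (intro Max_ge) force+
  ultimately have "last_crossing \<sigma> T I X Z"
    unfolding last_crossing_def using X_max Z_max by (fastforce simp: less_le)
  with that show thesis .
qed

lemma last_crossing_unique:
  assumes "last_crossing \<sigma> T i x z" "last_crossing \<sigma> T j y w"
  shows "i = j \<and> x = y \<and> z = w"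
proof -
  have "y < x \<or> y = x \<and> (w < z \<or> w = z \<and> j \<le> i)" "x < y \<or> x = y \<and> (z < w \<or> z = w \<and> i \<le> j)"
    using assms by (auto simp: last_crossing_def)
  then show ?thesis by auto
qed

text \<open>A step to the right lowers a height by at most one, a step upwards raises it by at most one. As
neither step leads to another crossing, both inequalities for the heights must be equalities.\<close>
lemma extremal_crossing:
  assumes "config \<sigma> T" and cr: "crossing \<sigma> T i x z"
    and no_right: "\<And>w. \<not> crossing \<sigma> T i (x + 1) w" and no_up: "\<not> crossing \<sigma> T i x (z + 1)"
  shows "x = \<epsilon> i \<or> x \<in> fst (T i)" and "z \<in> snd (T (Suc i))"
    and "height (\<sigma> i) (T i) x z = int i" and "height (\<sigma> (Suc i)) (T (Suc i)) x z = int i"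
proof -
  have i: "Suc i < n" and arr: "T i \<in> arrays (\<sigma> i) i" "T (Suc i) \<in> arrays (\<sigma> (Suc i)) (Suc i)"
    using assms by (auto simp: config_def crossing_def)
  note fin = arr[THEN finite_rows_arrays]
  let ?h = "height (\<sigma> i) (T i)" and ?k = "height (\<sigma> (Suc i)) (T (Suc i))"
  have ge: "int i \<le> ?h x z" and le: "?k x z \<le> int i" using cr by (auto simp: crossing_def)
  have h_right: "?h (x + 1) w = ?h x w - of_bool (x \<in> fst (T i))" for w
    using fin by (simp add: height_def below_plus_one)
  have k_right: "?k (x + 1) w = ?k x w - of_bool (x \<in> fst (T (Suc i)))" for w
    using fin by (simp add: height_def below_plus_one)
  have k_up: "?k x (z + 1) = ?k x z + of_bool (z \<in> snd (T (Suc i)))"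
    using fin by (simp add: height_def below_plus_one)
  have "int i \<le> ?h x (z + 1)"
    using ge height_mono[of "T i" x x z "z + 1" "\<sigma> i"] fin by simp
  then have "\<not> ?k x (z + 1) \<le> int i"
    using cr no_up by (auto simp: crossing_def)
  with k_up le show z: "z \<in> snd (T (Suc i))" and k: "?k x z = int i" by (auto simp: of_bool_def split: if_splits)
  have right: "x = \<epsilon> i \<or> \<not> (int i \<le> ?h (x + 1) z \<and> ?k (x + 1) z \<le> int i)"
    using cr no_right[of z] by (auto simp: crossing_def)
  then show "x = \<epsilon> i \<or> x \<in> fst (T i)"
    using ge le h_right[of z] k_right[of z] by (auto simp: of_bool_def split: if_splits)
  show "?h x z = int i"
  proof (cases "x = \<epsilon> i")
    case True
    then show ?thesis using height_right_end[OF arr(1), of x z] ge below_le_card[of "snd (T i)" z] fin by simp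
  next
    case False
    with right h_right[of z] k_right[of z] k ge show ?thesis by (auto simp: of_bool_def split: if_splits)
  qed
qed

section \<open>Families without crossings\<close>
lemma height_le_above_start:
  assumes "T \<in> arrays u i" "\<beta> u \<le> z"
  shows "height u T x z \<le> int u + (z - \<beta> u)"
proof -
  have "below (snd T) (\<beta> u) = 0"
    using assms by (intro below_eq_0) (auto simp: arrays_def)
  then show ?thesis
    using below_growth[of "snd T" "\<beta> u" z] below_nonneg[of "fst T" x] assms finite_rows_arrays[OF assms(1)]
    by (simp add: height_def)
qed

lemma height_at_start:
  assumes "T \<in> arrays u i" "x \<le> \<alpha> u"
  shows "int u \<le> height u T x z"
proof -
  have "below (fst T) x = 0"
    using assms by (intro below_eq_0) (auto simp: arrays_def)
  then show ?thesis using below_nonneg[of "snd T" z] by (simp add: height_def)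
qed

lemma height_ge_right_of_start:
  assumes "T \<in> arrays u i" "\<alpha> u \<le> x"
  shows "int u - (x - \<alpha> u) \<le> height u T x z"
proof -
  have "below (fst T) (\<alpha> u) = 0"
    using assms by (intro below_eq_0) (auto simp: arrays_def)
  then show ?thesis
    using below_growth[of "fst T" "\<alpha> u" x] below_nonneg[of "snd T" z] assms finite_rows_arrays[OF assms(1)]
    by (simp add: height_def)
qed

text \<open>The first row has at least \<open>u - i\<close> entries, and there must be room for them.\<close>
lemma arrays_nonempty_bound:
  assumes "T \<in> arrays u i" "i \<le> u" "i < n"
  shows "\<alpha> u + int u \<le> \<epsilon> i + int i"
proof (cases "u = i")
  case True
  then show ?thesis using \<alpha>_le_\<epsilon> assms by simp
next
  case False
  then have "int u - int i \<le> int (card (fst T))" "card (fst T) > 0" 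
    using assms by (auto simp: arrays_def)
  moreover have "card (fst T) \<le> card {\<alpha> u..<\<epsilon> i}"
    using assms by (intro card_mono) (auto simp: arrays_def)
  ultimately show ?thesis by auto
qed

text \<open>If a point is strictly below the \<open>i\<close>-th array, then it is strictly below all previous ones, for
otherwise it is a crossing of some array with its successor. This argument fails for an array
that starts to the right of the point. If its start index is at least its end index, then the point
at the same level in the column of this start is weakly above the array; it is also weakly below
the next array, since it lies further to the right, so that it is a crossing. The other arrays of
this kind are excluded by assumption.\<close>
lemma height_chain:
  assumes cfg: "config \<sigma> T"
    and none: "\<And>j y w. j < i \<Longrightarrow> x \<le> y \<Longrightarrow> \<not> crossing \<sigma> T j y w"
    and i: "i < n" "height (\<sigma> i) (T i) x z < int i" "\<alpha> (\<sigma> i) \<le> x" "\<beta> (\<sigma> i) \<le> z"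
    and r: "\<And>r. p \<le> r \<Longrightarrow> r < i \<Longrightarrow>
      x \<le> \<epsilon> r \<and> \<beta> (\<sigma> r) \<le> z \<and> (\<sigma> r < r \<longrightarrow> \<alpha> (\<sigma> r) \<le> x)"
    and "p \<le> i"
  shows "height (\<sigma> p) (T p) x z < int p"
proof -
  have "height (\<sigma> p) (T p) x z < int p \<and> \<alpha> (\<sigma> p) \<le> x"
    using \<open>p \<le> i\<close> r
  proof (induction rule: inc_induct)
    case base
    then show ?case using i by simp
  next
    case (step m)
    then have IH: "height (\<sigma> (Suc m)) (T (Suc m)) x z \<le> int m" "\<alpha> (\<sigma> (Suc m)) \<le> x"
      by (auto simp: Suc_le_eq)
    have m: "x \<le> \<epsilon> m" "\<beta> (\<sigma> m) \<le> z" "\<sigma> m < m \<Longrightarrow> \<alpha> (\<sigma> m) \<le> x"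
      using step by auto
    have m': "Suc m < n" "\<beta> (\<sigma> (Suc m)) \<le> z"
      using step(1,2) step(4)[of "Suc m"] i by (cases "Suc m = i"; simp)+
    have arr: "T m \<in> arrays (\<sigma> m) m" "T (Suc m) \<in> arrays (\<sigma> (Suc m)) (Suc m)"
      using cfg m' by (auto simp: config_def)
    show ?case
    proof (cases "\<alpha> (\<sigma> m) \<le> x")
      case True
      then show ?thesis using none[of m x z] IH m m' step by (auto simp: crossing_def)
    next
      case False
      let ?y = "\<alpha> (\<sigma> m)"
      have "m \<le> \<sigma> m" using m False by (meson not_le)
      then have "int m \<le> height (\<sigma> m) (T m) ?y z" using height_at_start[OF arr(1), of ?y z] by simp
      moreover have "height (\<sigma> (Suc m)) (T (Suc m)) ?y z \<le> int m"
        using height_mono[of "T (Suc m)" x ?y z z "\<sigma> (Suc m)"] finite_rows_arrays[OF arr(2)] False IH by simp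
      moreover have "?y \<le> \<epsilon> m"
        using arrays_nonempty_bound[OF arr(1)] \<open>m \<le> \<sigma> m\<close> m' by simp
      ultimately have "crossing \<sigma> T m ?y z" using m m' IH False by (simp add: crossing_def)
      then show ?thesis using none[of m ?y z] False step by simp
    qed
  qed
  then show ?thesis ..
qed

text \<open>An array whose start index is smaller than its end index \<open>q0\<close> begins far up in the order of
the starts but has to end far down. Some array \<open>p\<close> before it does the converse, and between the
two a crossing must occur that is not to the left of the start of the array \<open>q0\<close>. As it is not
clear between which neighbours this happens, \<open>height_chain\<close> is used to carry a point that
is strictly below some array after \<open>p\<close> back to the array \<open>p\<close>, where it turns out to be weakly
above.\<close>
lemma early_start_bound:
  assumes cfg: "config \<sigma> T"
    and none: "\<And>j y w. x0 \<le> y \<Longrightarrow> \<not> crossing \<sigma> T j y w"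
    and q0: "q0 < n" "\<sigma> q0 < q0"
  shows "\<alpha> (\<sigma> q0) \<le> x0"
proof (rule ccontr)
  assume contra: "\<not> \<alpha> (\<sigma> q0) \<le> x0"
  have perm: "\<sigma> permutes {0..<n}" and arr: "\<And>i. i < n \<Longrightarrow> T i \<in> arrays (\<sigma> i) i"
    using cfg by (auto simp: config_def)
  have inj: "inj \<sigma>" using perm by (rule permutes_inj)
  have \<sigma>_less: "\<sigma> i < n" if "i < n" for i using permutes_in_image[OF perm, of i] that by simp
  \<comment> \<open>Taking the rightmost start \<open>x\<close> of this kind keeps all other such starts weakly left of \<open>x\<close>.\<close>
  let ?Q = "{q. q < n \<and> \<sigma> q < q}"
  define x where "x = Max ((\<lambda>q. \<alpha> (\<sigma> q)) ` ?Q)"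
  have "x \<in> (\<lambda>q. \<alpha> (\<sigma> q)) ` ?Q"
    unfolding x_def using q0 by (intro Max_in) auto
  then obtain q where q: "q < n" "\<sigma> q < q" "x = \<alpha> (\<sigma> q)" by auto
  have x_max: "\<alpha> (\<sigma> r) \<le> x" if "r < n" "\<sigma> r < r" for r
    unfolding x_def using that by (intro Max_ge) auto
  have "x0 < x" using x_max[OF q0] contra by simp
  define v where "v = \<sigma> q"
  \<comment> \<open>Since the value \<open>v\<close> is taken outside \<open>{..v}\<close>, the permutation maps some \<open>p \<le> v\<close> above \<open>v\<close>.\<close>
  let ?P = "{p. p \<le> v \<and> v < \<sigma> p}"
  have "?P \<noteq> {}"
  proof
    assume "?P = {}"
    then have "\<sigma> p \<in> {..v} - {v}" if "p \<in> {..v}" for p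
      using that q inj_eq[OF inj, of p q] by (auto simp: v_def not_less)
    then have "\<sigma> ` {..v} \<subseteq> {..v} - {v}" by (rule image_subsetI)
    then have "card (\<sigma> ` {..v}) \<le> card ({..v} - {v})" by (rule card_mono[rotated]) simp
    then show False using inj by (simp add: card_image inj_on_subset[of _ UNIV])
  qed
  define p where "p = Max ?P"
  have fin: "finite ?P" by simp
  have p: "p \<le> v" "v < \<sigma> p"
    using Max_in[OF fin \<open>?P \<noteq> {}\<close>] unfolding p_def by auto
  have p_max: "\<sigma> r \<le> v" if "p < r" "r \<le> v" for r
  proof (rule ccontr)
    assume "\<not> \<sigma> r \<le> v"
    then have "r \<le> p" unfolding p_def using that fin by (intro Max_ge) auto
    with that show False by simp
  qed
  \<comment> \<open>The array \<open>r\<close> has fewer than \<open>r - \<sigma> r\<close> second-row entries below \<open>lift r\<close>, hence height less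
    than \<open>r\<close> at this level. The highest such level is needed to stay above the starts between \<open>p\<close>
    and the array \<open>s\<close> where it is attained.\<close>
  define lift where "lift r = \<beta> (\<sigma> r) + int r - 1 - int (\<sigma> r)" for r
  let ?R = "{r. p \<le> r \<and> r \<le> q \<and> \<sigma> r < r}"
  define z where "z = Max (lift ` ?R)"
  have "z \<in> lift ` ?R"
    unfolding z_def using p q by (intro Max_in) (auto simp: v_def)
  then obtain s where s: "p \<le> s" "s \<le> q" "\<sigma> s < s" "z = lift s" by auto
  have z_max: "lift r \<le> z" if "p \<le> r" "r \<le> q" "\<sigma> r < r" for r
    unfolding z_def using that by (intro Max_ge) auto
  have "s < n" "p < n" "v < n" using s p q by (auto simp: v_def)
  have p_bound: "\<beta> (\<sigma> p) \<le> z"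
    using z_max[of q] p q \<beta>_antimono[of v "\<sigma> p"] \<sigma>_less[OF \<open>p < n\<close>] by (auto simp: lift_def v_def)
  have \<alpha>p: "x + int v \<le> \<alpha> (\<sigma> p) + int (\<sigma> p)"
    using \<alpha>_step[of v "\<sigma> p"] p q \<sigma>_less[OF \<open>p < n\<close>] by (simp add: v_def)
  have start_bound: "\<beta> (\<sigma> r) \<le> z" if r: "p \<le> r" "r < s" for r
  proof (cases "\<sigma> r < r")
    case True
    then show ?thesis using z_max[of r] r s by (auto simp: lift_def)
  next
    case False
    show ?thesis
    proof (rule ccontr)
      assume neg: "\<not> \<beta> (\<sigma> r) \<le> z"
      then have "p < r" using p_bound r by (cases "p = r") auto
      \<comment> \<open>A start above the level \<open>z\<close> precedes all starts that contribute to \<open>z\<close>. Then \<open>\<sigma>\<close>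
        maps \<open>{Suc r..v}\<close> into itself and misses \<open>v\<close>.\<close>
      have later: "\<sigma> r < \<sigma> r'" if r': "p \<le> r'" "r' \<le> q" "\<sigma> r' < r'" for r'
      proof (rule ccontr)
        assume "\<not> \<sigma> r < \<sigma> r'"
        then have "\<beta> (\<sigma> r) \<le> \<beta> (\<sigma> r')"
          using r s q by (intro \<beta>_antimono \<sigma>_less) auto
        with z_max[OF r'] neg r' show False by (simp add: lift_def)
      qed
      have "\<sigma> r < v" using later[of q] p q by (simp add: v_def)
      then have "r < v" using False by simp
      have "\<sigma> r' \<in> {Suc r..v} - {v}" if r': "r' \<in> {Suc r..v}" for r'
      proof -
        have "r < \<sigma> r'"
          using later[of r'] r' \<open>p < r\<close> q False by (cases "\<sigma> r' < r'") (auto simp: v_def)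
        moreover have "\<sigma> r' \<le> v" using p_max[of r'] r' \<open>p < r\<close> by simp
        moreover have "\<sigma> r' \<noteq> v" using r' q by (auto simp: v_def inj_eq[OF inj])
        ultimately show ?thesis by simp
      qed
      then have "\<sigma> ` {Suc r..v} \<subseteq> {Suc r..v} - {v}" by (rule image_subsetI)
      then have "card (\<sigma> ` {Suc r..v}) \<le> card ({Suc r..v} - {v})" by (rule card_mono[rotated]) simp
      then show False using inj \<open>r < v\<close> by (simp add: card_image inj_on_subset[of _ UNIV])
    qed
  qed
  have "height (\<sigma> p) (T p) x z < int p"
  proof (rule height_chain[OF cfg])
    show "\<not> crossing \<sigma> T j y w" if "x \<le> y" for j y w using none[of y] that \<open>x0 < x\<close> by simp
    show "s < n" "p \<le> s" "\<alpha> (\<sigma> s) \<le> x" using s x_max \<open>s < n\<close> by auto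
    show "\<beta> (\<sigma> s) \<le> z" using s by (simp add: lift_def)
    then show "height (\<sigma> s) (T s) x z < int s"
      using height_le_above_start[OF arr[OF \<open>s < n\<close>], of z x] s by (simp add: lift_def)
  next
    fix r assume r: "p \<le> r" "r < s"
    have "\<alpha> (\<sigma> p) + int (\<sigma> p) \<le> \<epsilon> p + int p"
      using arrays_nonempty_bound[OF arr[OF \<open>p < n\<close>]] p \<open>p < n\<close> by simp
    then have "x \<le> \<epsilon> p" using \<alpha>p p by simp
    also have "\<epsilon> p \<le> \<epsilon> r" using \<epsilon>_mono r \<open>s < n\<close> by simp
    finally show "x \<le> \<epsilon> r \<and> \<beta> (\<sigma> r) \<le> z \<and> (\<sigma> r < r \<longrightarrow> \<alpha> (\<sigma> r) \<le> x)"
      using start_bound[OF r] x_max r \<open>s < n\<close> by simp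
  qed
  moreover have "int p \<le> height (\<sigma> p) (T p) x z"
  proof (cases "\<alpha> (\<sigma> p) \<le> x")
    case True
    then show ?thesis
      using height_ge_right_of_start[OF arr[OF \<open>p < n\<close>] True, of z] \<alpha>p p by linarith
  next
    case False
    then show ?thesis
      using height_at_start[OF arr[OF \<open>p < n\<close>], of x z] p by linarith
  qed
  ultimately show False by simp
qed

text \<open>A permutation other than the identity has an index \<open>q\<close> with \<open>\<sigma> q < q\<close>, and
\<open>early_start_bound\<close> may be applied with a bound to the left of the start of this array.\<close>
lemma crossing_if_not_id:
  assumes "config \<sigma> T" "\<sigma> \<noteq> id"
  shows "\<exists>i x z. crossing \<sigma> T i x z"
proof (rule ccontr)
  assume none: "\<nexists>i x z. crossing \<sigma> T i x z"
  have perm: "\<sigma> permutes {0..<n}" using assms by (simp add: config_def)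
  have "\<exists>q. q < n \<and> \<sigma> q < q"
  proof (rule ccontr)
    assume "\<nexists>q. q < n \<and> \<sigma> q < q"
    then have "\<forall>q\<in>{0..<n}. q \<le> \<sigma> q" by (metis atLeastLessThan_iff not_less)
    with permutes_natset_ge[OF perm] assms(2) show False by blast
  qed
  then obtain q where q: "q < n" "\<sigma> q < q" by blast
  have "\<alpha> (\<sigma> q) \<le> \<alpha> (\<sigma> q) - 1"
    by (rule early_start_bound[OF assms(1) _ q]) (use none in blast)
  then show False by simp
qed

end

section \<open>Exchanging the beginnings of two arrays\<close>
definition rows_size :: "rows \<Rightarrow> nat" where
  "rows_size T = card (fst T) + card (snd T)"

lemma rows_size_splice:
  assumes "finite_rows T" "finite_rows U"
  shows "rows_size (splice_rows x z T U) + rows_size (splice_rows x z U T) = rows_size T + rows_size U"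
proof -
  have "int (rows_size (splice_rows x z T U) + rows_size (splice_rows x z U T)) = int (rows_size T + rows_size U)"
    using assms card_graft[of "fst T" "fst U" x] card_graft[of "fst U" "fst T" x]
      card_graft[of "snd T" "snd U" z] card_graft[of "snd U" "snd T" z]
    by (simp add: rows_size_def splice_rows_def)
  then show ?thesis by (simp only: of_nat_eq_iff)
qed

definition swap_starts :: "nat \<Rightarrow> (nat \<Rightarrow> nat) \<Rightarrow> nat \<Rightarrow> nat" where
  "swap_starts i \<sigma> = \<sigma> \<circ> transpose i (Suc i)"

definition swap_prefixes :: "nat \<Rightarrow> int \<Rightarrow> int \<Rightarrow> (nat \<Rightarrow> rows) \<Rightarrow> nat \<Rightarrow> rows" where
  "swap_prefixes i x z T =
     T(i := splice_rows x z (T (Suc i)) (T i), Suc i := splice_rows x z (T i) (T (Suc i)))"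

lemma swap_starts_simps [simp]:
  "swap_starts i \<sigma> i = \<sigma> (Suc i)" "swap_starts i \<sigma> (Suc i) = \<sigma> i"
  "j \<noteq> i \<Longrightarrow> j \<noteq> Suc i \<Longrightarrow> swap_starts i \<sigma> j = \<sigma> j"
  by (simp_all add: swap_starts_def)

lemma swap_prefixes_simps [simp]:
  "swap_prefixes i x z T i = splice_rows x z (T (Suc i)) (T i)"
  "swap_prefixes i x z T (Suc i) = splice_rows x z (T i) (T (Suc i))"
  "j \<noteq> i \<Longrightarrow> j \<noteq> Suc i \<Longrightarrow> swap_prefixes i x z T j = T j"
  by (simp_all add: swap_prefixes_def)

lemma swap_starts_swap_starts: "swap_starts i (swap_starts i \<sigma>) = \<sigma>"
  by (simp add: swap_starts_def comp_assoc)

lemma swap_prefixes_swap_prefixes: "swap_prefixes i x z (swap_prefixes i x z T) = T"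
  by (rule ext) (simp add: swap_prefixes_def splice_splice)

context ladder_rows
begin

lemma arrays_splice:
  assumes "U \<in> arrays v j" "T \<in> arrays u i"
    and "\<alpha> v \<le> x" "x \<le> \<epsilon> i" "\<beta> v \<le> z" "z \<le> \<delta> i"
    and "height v U x z = height u T x z"
  shows "splice_rows x z U T \<in> arrays v i"
proof -
  note fin = assms(1,2)[THEN finite_rows_arrays]
  have "int (card (graft x (fst U) (fst T))) + int i = int (card (graft z (snd U) (snd T))) + int v"
    using assms fin by (auto simp: card_graft arrays_def height_def)
  then have "card (graft x (fst U) (fst T)) + i = card (graft z (snd U) (snd T)) + v"
    by linarith
  then show ?thesis
    using assms by (fastforce simp: arrays_def splice_rows_def graft_def)
qed

text \<open>To the right of the first end point at most \<open>i\<close> second-row entries reach the boundary of the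
ladder, because the \<open>i\<close>-th end point is, up to the shift by \<open>i\<close>, not higher than the first one. So
the ladder condition holds automatically there.\<close>
lemma height_ladder_past_end:
  assumes "T \<in> arrays u i" "i < n" "\<epsilon> 0 \<le> x"
  shows "0 \<le> height u T (x + 1) (g x)"
proof -
  note fin = finite_rows_arrays[OF assms(1)]
  have g: "\<delta> 0 \<le> g x" using g_ge_end assms by simp
  have \<delta>: "\<delta> i - int i \<le> \<delta> 0" using \<delta>_step[of 0 i] assms by simp
  have all: "below (snd T) y = int (card (snd T))" if "\<delta> i \<le> y" for y
    using assms that by (intro below_eq_card) (auto simp: arrays_def)
  have "int (card (snd T)) - int i \<le> below (snd T) (g x)"
  proof (cases "g x \<le> \<delta> i")
    case True
    then show ?thesis using below_growth[of "snd T" "g x" "\<delta> i"] all[of "\<delta> i"] fin g \<delta> by simp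
  qed (use all in auto)
  moreover have "int (card (fst T)) + int i = int (card (snd T)) + int u"
    using assms by (auto simp: arrays_def)
  ultimately show ?thesis
    using below_le_card[of "fst T" "x + 1"] fin by (simp add: height_def)
qed

text \<open>Where the boundary passes the point \<open>(x, z)\<close> in front or behind, its height is one of the old
ones, and above the point the height is at least the one at the point. The only dangerous case is
that the boundary passes below the point on its right, which the assumption \<open>corner\<close> confines to
the part past the first end.\<close>
lemma in_ladder_splice:
  assumes arr: "U \<in> arrays v j" "T \<in> arrays u i" "splice_rows x z U T \<in> arrays v i" "i < n"
    and lad: "in_ladder v U" "in_ladder u T"
    and eq: "height v U x z = height u T x z" and pos: "0 \<le> height u T x z"
    and corner: "x < \<epsilon> 0 \<Longrightarrow> z \<le> g x"
  shows "in_ladder v (splice_rows x z U T)"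
  unfolding in_ladder_def
proof
  fix y
  note fin = arr(1,2)[THEN finite_rows_arrays]
  consider "y + 1 \<le> x" "g y \<le> z" | "y + 1 \<le> x" "z \<le> g y" | "x \<le> y" "z \<le> g y" | "x \<le> y" "g y < z"
    by linarith
  then show "0 \<le> height v (splice_rows x z U T) (y + 1) (g y)"
  proof cases
    case 1
    then show ?thesis using lad fin by (simp add: height_splice_before in_ladder_def)
  next
    case 2
    have "height v (splice_rows x z U T) x z \<le> height v (splice_rows x z U T) (y + 1) (g y)"
      using 2 fin by (intro height_mono finite_splice)
    then show ?thesis using fin pos eq by (simp add: height_splice_before)
  next
    case 3
    then show ?thesis using lad fin eq height_splice_after[OF fin, of x "y + 1" z "g y" v u]
      by (simp add: in_ladder_def)
  next
    case 4
    then have "\<epsilon> 0 \<le> y" using corner g_mono[of x y] by linarith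
    then show ?thesis by (rule height_ladder_past_end[OF arr(3,4)])
  qed
qed

lemma last_crossing_extremal:
  assumes "config \<sigma> T" "last_crossing \<sigma> T i x z"
  shows "x = \<epsilon> i \<or> x \<in> fst (T i)" and "z \<in> snd (T (Suc i))"
    and "height (\<sigma> i) (T i) x z = int i" and "height (\<sigma> (Suc i)) (T (Suc i)) x z = int i"
proof -
  have cr: "crossing \<sigma> T i x z" using assms by (simp add: last_crossing_def)
  have right: "\<not> crossing \<sigma> T i (x + 1) w" for w
    using assms(2) unfolding last_crossing_def by (metis less_irrefl zless_add1_eq add.commute less_add_one not_less_iff_gr_or_eq)
  have up: "\<not> crossing \<sigma> T i x (z + 1)"
    using assms(2) unfolding last_crossing_def by fastforce
  note extremal_crossing[OF assms(1) cr right up]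
  then show "x = \<epsilon> i \<or> x \<in> fst (T i)" and "z \<in> snd (T (Suc i))"
    and "height (\<sigma> i) (T i) x z = int i" and "height (\<sigma> (Suc i)) (T (Suc i)) x z = int i"
    by blast+
qed

text \<open>To the right of the last crossing the point is strictly below the \<open>i\<close>-th array, hence by
\<open>height_chain\<close> strictly below the first one, which itself respects the ladder.\<close>
lemma last_crossing_in_ladder:
  assumes cfg: "config \<sigma> T" and last: "last_crossing \<sigma> T i x z"
    and lad: "in_ladder (\<sigma> 0) (T 0)" and "x < \<epsilon> 0"
  shows "z < g x"
proof (cases "\<exists>r\<le>i. z < \<beta> (\<sigma> r)")
  case True
  then obtain r where r: "r \<le> i" "z < \<beta> (\<sigma> r)" by blast
  have "i < n" and "\<sigma> permutes {0..<n}" using cfg last by (auto simp: config_def last_crossing_def crossing_def)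
  then have "\<sigma> r < n" using permutes_in_image[of \<sigma> "{0..<n}" r] r by simp
  then have "\<beta> (\<sigma> r) \<le> \<beta> 0" by (intro \<beta>_antimono) auto
  with r g_ge[of x] show ?thesis by simp
next
  case False
  have i: "Suc i < n" "\<alpha> (\<sigma> i) \<le> x" using last by (auto simp: last_crossing_def crossing_def)
  have none: "\<not> crossing \<sigma> T j y w" if "x + 1 \<le> y" for j y w
    using last that unfolding last_crossing_def by fastforce
  have fin: "finite_rows (T r)" if "r < n" for r
    using cfg that by (auto simp: config_def dest: finite_rows_arrays)
  have "x < \<epsilon> r" if "r < n" for r using assms(4) \<epsilon>_mono[of 0 r] that by simp
  note \<epsilon> = this
  have "x \<in> fst (T i)" using last_crossing_extremal(1)[OF cfg last] \<epsilon>[of i] i by auto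
  then have start: "height (\<sigma> i) (T i) (x + 1) z < int i"
    using last_crossing_extremal(3)[OF cfg last] fin[of i] i by (simp add: height_def below_plus_one)
  have "height (\<sigma> 0) (T 0) (x + 1) z < int 0"
  proof (rule height_chain[OF cfg, where i = i])
    show "x + 1 \<le> \<epsilon> r \<and> \<beta> (\<sigma> r) \<le> z \<and> (\<sigma> r < r \<longrightarrow> \<alpha> (\<sigma> r) \<le> x + 1)" if "r < i" for r
      using that \<epsilon>[of r] i False early_start_bound[OF cfg none, of "x + 1" r] by (auto simp: not_less)
  qed (use none i False start in auto)
  moreover have "0 \<le> height (\<sigma> 0) (T 0) (x + 1) (g x)"
    using lad by (simp add: in_ladder_def)
  moreover have "height (\<sigma> 0) (T 0) (x + 1) (g x) \<le> height (\<sigma> 0) (T 0) (x + 1) z" if "g x \<le> z"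
    using that fin[of 0] i by (intro height_mono) auto
  ultimately show ?thesis by force
qed

text \<open>Behind the last crossing all heights stay the same. It remains to see that no new crossing arises to
its right at a lower level, where the heights of the two modified arrays change: both are bounded
by the old heights at level \<open>z\<close>, so that such a crossing is either impossible or gives a later one
in the old family.\<close>
lemma swap_at_last_crossing:
  assumes cfg: "config \<sigma> T" and last: "last_crossing \<sigma> T i x z"
    and lad: "\<And>j. j < n \<Longrightarrow> in_ladder (\<sigma> j) (T j)"
  shows "config (swap_starts i \<sigma>) (swap_prefixes i x z T)"
    and "j < n \<Longrightarrow> in_ladder (swap_starts i \<sigma> j) (swap_prefixes i x z T j)"
    and "last_crossing (swap_starts i \<sigma>) (swap_prefixes i x z T) i x z"
proof -
  let ?\<sigma> = "swap_starts i \<sigma>" and ?T = "swap_prefixes i x z T"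
  let ?h = "\<lambda>j. height (\<sigma> j) (T j)" and ?h' = "\<lambda>j. height (?\<sigma> j) (?T j)"
  have cr: "crossing \<sigma> T i x z" using last by (simp add: last_crossing_def)
  then have i: "Suc i < n" by (simp add: crossing_def)
  have perm: "\<sigma> permutes {0..<n}" using cfg by (simp add: config_def)
  have perm': "?\<sigma> permutes {0..<n}"
    unfolding swap_starts_def using i by (intro permutes_compose perm permutes_swap_id) auto
  have arr: "T j \<in> arrays (\<sigma> j) j" if "j < n" for j
    using cfg that by (auto simp: config_def)
  have fin: "finite_rows (T j)" if "j < n" for j using arr[OF that] by (rule finite_rows_arrays)
  have fin': "finite_rows (?T j)" if "j < n" for j
    using i fin[OF that] finite_splice[OF fin fin, of i "Suc i" x z] finite_splice[OF fin fin, of "Suc i" i x z]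
    by (cases "j = i"; cases "j = Suc i") auto
  note ext = last_crossing_extremal[OF cfg last]
  have box: "\<alpha> (\<sigma> i) \<le> x" "\<alpha> (\<sigma> (Suc i)) \<le> x" "x \<le> \<epsilon> i" "\<beta> (\<sigma> i) \<le> z" "\<beta> (\<sigma> (Suc i)) \<le> z"
    using cr by (auto simp: crossing_def)
  have \<epsilon>: "\<epsilon> i \<le> \<epsilon> (Suc i)" using \<epsilon>_mono i by simp
  have z: "z < \<delta> (Suc i)" by (rule crossing_z_bound[OF cfg cr])
  then have z': "z \<le> \<delta> i" using \<delta>_step[of i "Suc i"] i by simp
  have corner: "x < \<epsilon> 0 \<Longrightarrow> z \<le> g x" using last_crossing_in_ladder[OF cfg last lad] i by simp
  have "splice_rows x z (T (Suc i)) (T i) \<in> arrays (\<sigma> (Suc i)) i"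
    "splice_rows x z (T i) (T (Suc i)) \<in> arrays (\<sigma> i) (Suc i)"
    using box \<epsilon> z z' ext i by (auto intro!: arrays_splice arr)
  moreover from this have "in_ladder (\<sigma> (Suc i)) (splice_rows x z (T (Suc i)) (T i))"
    "in_ladder (\<sigma> i) (splice_rows x z (T i) (T (Suc i)))"
    using ext i corner by (auto intro!: in_ladder_splice arr lad)
  ultimately have new: "?T j \<in> arrays (?\<sigma> j) j \<and> in_ladder (?\<sigma> j) (?T j)" if "j < n" for j
    using arr[OF that] lad[OF that] by (cases "j = i"; cases "j = Suc i") auto
  with perm' show "config ?\<sigma> ?T" by (simp add: config_def)
  show "j < n \<Longrightarrow> in_ladder (?\<sigma> j) (?T j)" using new by blast
  have after: "?h' j y w = ?h j y w" if "x \<le> y" "z \<le> w" "j < n" for j y w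
    using that i ext fin height_splice_after[of "T (Suc i)" "T i" x y z w "\<sigma> (Suc i)" "\<sigma> i"]
      height_splice_after[of "T i" "T (Suc i)" x y z w "\<sigma> i" "\<sigma> (Suc i)"]
    by (cases "j = i"; cases "j = Suc i") simp_all
  have cr': "crossing ?\<sigma> ?T i x z"
    using box i after[of x z i] after[of x z "Suc i"] ext by (auto simp: crossing_def)
  show "last_crossing ?\<sigma> ?T i x z"
    unfolding last_crossing_def
  proof (intro conjI allI impI cr')
    fix j y w assume new: "crossing ?\<sigma> ?T j y w"
    then have j: "Suc j < n" by (simp add: crossing_def)
    have none: "\<not> crossing \<sigma> T k y v" if "x < y" for k v
      using last that unfolding last_crossing_def by fastforce
    consider "y < x \<or> y = x \<and> w < z" | "x \<le> y" "z \<le> w" | "x < y" "w < z" by linarith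
    then show "y < x \<or> y = x \<and> (w < z \<or> w = z \<and> j \<le> i)"
    proof cases
      case 2
      have "\<alpha> (\<sigma> k) \<le> y \<and> \<beta> (\<sigma> k) \<le> w" if "\<alpha> (?\<sigma> k) \<le> y \<and> \<beta> (?\<sigma> k) \<le> w" for k
        using that 2 box by (cases "k = i"; cases "k = Suc i") auto
      then have "crossing \<sigma> T j y w"
        using new after[OF 2, of j] after[OF 2, of "Suc j"] j by (simp add: crossing_def)
      with last show ?thesis by (simp add: last_crossing_def)
    next
      case 3
      have drop: "?h' k y w \<le> ?h k y z" if "k < n" for k
        using height_mono[of "?T k" y y w z "?\<sigma> k"] fin'[OF that] after[of y z k] 3 that by simp
      have upper: "?h i y z < int i" if "x \<in> fst (T i)"
        using height_mono[of "T i" "x + 1" y z z "\<sigma> i"] 3 fin[of i] i ext(3) that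
        by (simp add: height_def below_plus_one)
      have lower: "?h (Suc i) y z \<le> int i"
        using height_mono[of "T (Suc i)" x y z z "\<sigma> (Suc i)"] 3 fin[of "Suc i"] i ext(4) by simp
      have x: "x \<in> fst (T i)" if "y \<le> \<epsilon> i" using ext(1) 3 that by auto
      consider "j = i" | "Suc j = i" | "j = Suc i" | "j \<noteq> i" "Suc j \<noteq> i" "j \<noteq> Suc i" by blast
      then show ?thesis
      proof cases
        case 1
        then show ?thesis using new drop[of i] upper x i by (auto simp: crossing_def)
      next
        case 2
        then have "y \<le> \<epsilon> j" "\<epsilon> j \<le> \<epsilon> i" using new \<epsilon>_mono[of j i] i by (auto simp: crossing_def)
        then have "?h i y z \<le> int j" using upper x 2 by simp
        moreover have "int j \<le> ?h j y z" using new 2 drop[of j] j by (auto simp: crossing_def)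
        ultimately have "crossing \<sigma> T j y z"
          using new 2 box 3 by (auto simp: crossing_def)
        with none 3 show ?thesis by blast
      next
        case c: 3
        then show ?thesis using new drop[of "Suc i"] lower i by (auto simp: crossing_def)
      next
        case 4
        then have "crossing \<sigma> T j y w" using new by (auto simp: crossing_def)
        with none 3 show ?thesis by blast
      qed
    qed auto
  qed
qed

section \<open>The determinant as a sum over families without crossings\<close>
definition entry :: "nat \<Rightarrow> nat \<Rightarrow> rows set" where
  "entry u i = {U \<in> arrays u i. in_ladder u U}"

definition configs :: "((nat \<Rightarrow> nat) \<times> (nat \<Rightarrow> rows)) set" where
  "configs = (SIGMA \<sigma>:{\<sigma>. \<sigma> permutes {0..<n}}. \<Pi>\<^sub>E i\<in>{0..<n}. entry (\<sigma> i) i)"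

definition uncrossed :: "(nat \<Rightarrow> rows) set" where
  "uncrossed = {T \<in> (\<Pi>\<^sub>E i\<in>{0..<n}. entry i i). \<forall>i x z. \<not> crossing id T i x z}"

lemma finite_entry: "finite (entry u i)"
proof (rule finite_subset)
  show "entry u i \<subseteq> Pow {\<alpha> u..<\<epsilon> i} \<times> Pow {\<beta> u..<\<delta> i}"
    by (auto simp: entry_def arrays_def)
qed simp

lemma configsD:
  assumes "(\<sigma>, T) \<in> configs"
  shows "config \<sigma> T" and "i < n \<Longrightarrow> in_ladder (\<sigma> i) (T i)"
  using assms by (auto simp: configs_def config_def entry_def PiE_iff)

text \<open>The weight \<open>w\<close> only has to be a function for which the product over two arrays depends on the sum
of their sizes, since this sum is what an exchange preserves.\<close>
lemma sum_configs:
  fixes w :: "rows \<Rightarrow> 'a :: {idom, ring_char_0}"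
  assumes w: "\<And>T U T' U'. rows_size T + rows_size U = rows_size T' + rows_size U' \<Longrightarrow>
    w T * w U = w T' * w U'"
  shows "(\<Sum>(\<sigma>, T)\<in>configs. signof \<sigma> * (\<Prod>i\<in>{0..<n}. w (T i))) =
    (\<Sum>T\<in>uncrossed. \<Prod>i\<in>{0..<n}. w (T i))"
proof -
  let ?f = "\<lambda>(\<sigma>, T). signof \<sigma> * (\<Prod>i\<in>{0..<n}. w (T i))"
  let ?X = "{(\<sigma>, T) \<in> configs. \<exists>i x z. crossing \<sigma> T i x z}"
  have fin: "finite configs"
    unfolding configs_def by (auto simp: finite_permutations finite_entry intro!: finite_SigmaI finite_PiE)
  have uncrossed: "configs - ?X = Pair id ` uncrossed"
  proof -
    have id: "\<sigma> = id" if "(\<sigma>, T) \<in> configs - ?X" for \<sigma> T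
      using crossing_if_not_id[of \<sigma> T] configsD(1)[of \<sigma> T] that by auto
    have iff: "(\<sigma>, T) \<in> configs - ?X \<longleftrightarrow> \<sigma> = id \<and> T \<in> uncrossed" for \<sigma> T
      using id[of \<sigma> T] by (cases "\<sigma> = id") (auto simp: configs_def uncrossed_def permutes_id simp flip: id_def)
    show ?thesis
    proof (rule Set.set_eqI)
      fix c show "c \<in> configs - ?X \<longleftrightarrow> c \<in> Pair id ` uncrossed"
        using iff[of "fst c" "snd c"] by (cases c) (simp only: fst_conv snd_conv image_iff, blast)
    qed
  qed
  define last where "last = (\<lambda>(\<sigma>, T). THE (i, x, z). last_crossing \<sigma> T i x z)"
  define swap where "swap = (\<lambda>(\<sigma>, T). case last (\<sigma>, T) of
    (i, x, z) \<Rightarrow> (swap_starts i \<sigma>, swap_prefixes i x z T))"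
  have last: "last (\<sigma>, T) = (i, x, z)" if "last_crossing \<sigma> T i x z" for \<sigma> T i x z
    unfolding last_def using that by (auto intro!: the_equality dest: last_crossing_unique[OF that])
  have swap: "swap (swap c) = c \<and> swap c \<in> ?X \<and> ?f (swap c) = - ?f c" if "c \<in> ?X" for c
  proof -
    obtain \<sigma> T where c: "c = (\<sigma>, T)" by (cases c)
    with that obtain j y v where T: "(\<sigma>, T) \<in> configs" and "crossing \<sigma> T j y v" by auto
    note cfg = configsD(1)[OF T] and lad = configsD(2)[OF T]
    from last_crossing_exists[OF cfg \<open>crossing \<sigma> T j y v\<close>]
    obtain i x z where l: "last_crossing \<sigma> T i x z" by blast
    let ?\<sigma> = "swap_starts i \<sigma>" and ?T = "swap_prefixes i x z T"
    note new = swap_at_last_crossing[OF cfg l lad]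
    have i: "Suc i < n" using l by (simp add: last_crossing_def crossing_def)
    have perm: "\<sigma> permutes {0..<n}" using cfg by (simp add: config_def)
    have sc: "swap c = (?\<sigma>, ?T)" using last[OF l] by (simp add: c swap_def)
    have "swap (swap c) = c"
      using last[OF new(3)] unfolding sc
      by (simp add: swap_def swap_starts_swap_starts swap_prefixes_swap_prefixes c)
    moreover have "?T \<in> extensional {0..<n}"
      using T i by (auto simp: configs_def PiE_iff extensional_def swap_prefixes_def)
    then have "swap c \<in> ?X"
      using new by (auto simp: sc configs_def config_def entry_def PiE_iff last_crossing_def)
    moreover have "?f (swap c) = - ?f c"
    proof -
      have "sign ?\<sigma> = - sign \<sigma>"
        using perm by (simp add: swap_starts_def sign_compose permutes_imp_permutation[of "{0..<n}"]
          permutation_swap_id sign_swap_id)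
      then have sgn: "signof ?\<sigma> = (- signof \<sigma> :: 'a)" by simp
      have fin: "finite_rows (T i)" "finite_rows (T (Suc i))"
        using cfg i finite_rows_arrays[of "T i" "\<sigma> i" i]
          finite_rows_arrays[of "T (Suc i)" "\<sigma> (Suc i)" "Suc i"] by (auto simp: config_def)
      have split: "(\<Prod>j\<in>{0..<n}. w (S j)) = (\<Prod>j\<in>{0..<n} - {i, Suc i}. w (S j)) * (w (S i) * w (S (Suc i)))"
        for S :: "nat \<Rightarrow> rows"
      proof -
        have "{0..<n} = insert i (insert (Suc i) ({0..<n} - {i, Suc i}))" using i by auto
        then have "(\<Prod>j\<in>{0..<n}. w (S j)) = (\<Prod>j\<in>insert i (insert (Suc i) ({0..<n} - {i, Suc i})). w (S j))"
          by simp
        also have "\<dots> = w (S i) * (w (S (Suc i)) * (\<Prod>j\<in>{0..<n} - {i, Suc i}. w (S j)))"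
          by (subst prod.insert; simp)+
        finally show ?thesis by (simp add: ac_simps)
      qed
      have "w (?T i) * w (?T (Suc i)) = w (T i) * w (T (Suc i))"
        by (rule w) (use rows_size_splice[OF fin(2,1)] in simp)
      moreover have "(\<Prod>j\<in>{0..<n} - {i, Suc i}. w (?T j)) = (\<Prod>j\<in>{0..<n} - {i, Suc i}. w (T j))"
        by (intro prod.cong) auto
      ultimately show ?thesis unfolding sc using sgn by (simp add: split c)
    qed
    ultimately show ?thesis by blast
  qed
  have "sum ?f ?X = (\<Sum>c\<in>?X. - ?f c)"
    by (rule sum.reindex_bij_witness[of _ swap swap]) (use swap in auto)
  then have "sum ?f ?X = - sum ?f ?X" by (simp add: sum_negf)
  then have "sum ?f ?X = 0" by simp
  moreover have "sum ?f configs = sum ?f ?X + sum ?f (configs - ?X)"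
    using fin by (subst sum.subset_diff[of ?X]) (auto simp: add.commute)
  ultimately have "sum ?f configs = sum ?f (Pair id ` uncrossed)" by (simp add: uncrossed)
  also have "\<dots> = (\<Sum>T\<in>uncrossed. \<Prod>i\<in>{0..<n}. w (T i))"
    by (subst sum.reindex) (auto simp: inj_on_def)
  finally show ?thesis .
qed

lemma det_entries:
  fixes w :: "rows \<Rightarrow> 'a :: {idom, ring_char_0}"
  assumes w: "\<And>T U T' U'. rows_size T + rows_size U = rows_size T' + rows_size U' \<Longrightarrow>
    w T * w U = w T' * w U'"
  shows "det (mat n n (\<lambda>(i, j). \<Sum>U\<in>entry j i. w U)) = (\<Sum>T\<in>uncrossed. \<Prod>i\<in>{0..<n}. w (T i))"
proof -
  have "det (mat n n (\<lambda>(i, j). \<Sum>U\<in>entry j i. w U)) =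
      (\<Sum>\<sigma> | \<sigma> permutes {0..<n}. signof \<sigma> * (\<Prod>i\<in>{0..<n}. \<Sum>U\<in>entry (\<sigma> i) i. w U))"
    by (subst det_def'[of _ n]) (auto intro!: sum.cong prod.cong simp: permutes_in_image)
  also have "\<dots> = (\<Sum>\<sigma> | \<sigma> permutes {0..<n}. \<Sum>T\<in>(\<Pi>\<^sub>E i\<in>{0..<n}. entry (\<sigma> i) i).
      signof \<sigma> * (\<Prod>i\<in>{0..<n}. w (T i)))"
    by (intro sum.cong refl) (simp add: prod_sum_PiE finite_entry sum_distrib_left)
  also have "\<dots> = (\<Sum>(\<sigma>, T)\<in>configs. signof \<sigma> * (\<Prod>i\<in>{0..<n}. w (T i)))"
    unfolding configs_def by (subst sum.Sigma) (auto simp: finite_permutations finite_entry intro!: finite_PiE)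
  also note sum_configs[OF w]
  finally show ?thesis .
qed

end

section \<open>Lattice paths and their NE-turns\<close>
lemma NE_turns_short: "NE_turns [p] = {}" "NE_turns [p, q] = {}"
  by (auto simp: NE_turns_def)

lemma NE_turns_Cons:
  "NE_turns (p # q # r # P) =
     (if vertical_step p q \<and> horizontal_step q r then {q} else {}) \<union> NE_turns (q # r # P)"
  (is "?L = ?T \<union> ?R")
proof (intro equalityI subsetI)
  fix x assume "x \<in> ?L"
  then obtain i where i: "0 < i" "Suc i < length (p # q # r # P)" "x = (p # q # r # P) ! i"
    "vertical_step ((p # q # r # P) ! (i - 1)) ((p # q # r # P) ! i)"
    "horizontal_step ((p # q # r # P) ! i) ((p # q # r # P) ! Suc i)"
    unfolding NE_turns_def by auto
  then obtain j where j: "i = Suc j" by (cases i) auto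
  show "x \<in> ?T \<union> ?R"
  proof (cases j)
    case 0
    then show ?thesis using i j by auto
  next
    case (Suc k)
    then have "x \<in> ?R" unfolding NE_turns_def using i j by (intro CollectI exI[of _ j]) auto
    then show ?thesis ..
  qed
next
  fix x assume "x \<in> ?T \<union> ?R"
  then show "x \<in> ?L"
  proof
    assume "x \<in> ?T"
    then show ?thesis unfolding NE_turns_def by (intro CollectI exI[of _ 1]) (auto split: if_splits)
  next
    assume "x \<in> ?R"
    then obtain i where i: "0 < i" "Suc i < length (q # r # P)" "x = (q # r # P) ! i"
      "vertical_step ((q # r # P) ! (i - 1)) ((q # r # P) ! i)"
      "horizontal_step ((q # r # P) ! i) ((q # r # P) ! Suc i)"
      unfolding NE_turns_def by auto
    then show ?thesis
      unfolding NE_turns_def by (intro CollectI exI[of _ "Suc i"]) (auto simp: nth_Cons')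
  qed
qed

lemma lattice_paths_iff:
  "P \<in> lattice_paths A E \<longleftrightarrow> P = [A] \<and> A = E \<or>
     (\<exists>Q. P = A # Q \<and> (Q \<in> lattice_paths (A + (1, 0)) E \<or> Q \<in> lattice_paths (A + (0, 1)) E))"
  (is "?L \<longleftrightarrow> ?R")
proof
  assume ?L
  then obtain Q where P: "P = A # Q"
    by (cases P) (auto simp: lattice_paths_def lattice_path_def)
  with \<open>?L\<close> show ?R
    by (cases Q) (auto simp: lattice_paths_def lattice_path_def horizontal_step_def vertical_step_def)
next
  assume ?R
  then show ?L
    by (auto simp: lattice_paths_def lattice_path_def horizontal_step_def vertical_step_def
        successively_Cons)
qed

lemma lattice_paths_hd: "P \<in> lattice_paths A E \<Longrightarrow> \<exists>Q. P = A # Q"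
  by (subst (asm) lattice_paths_iff) auto

lemma NE_turns_right: "Q \<in> lattice_paths (A + (1, 0)) E \<Longrightarrow> NE_turns (A # Q) = NE_turns Q"
proof -
  assume "Q \<in> lattice_paths (A + (1, 0)) E"
  then obtain Q' where "Q = (A + (1, 0)) # Q'" using lattice_paths_hd by blast
  then show ?thesis by (cases Q') (auto simp: NE_turns_short NE_turns_Cons vertical_step_def)
qed

lemma NE_turns_up: "Q \<in> lattice_paths (A + (0, 2)) E \<Longrightarrow>
    NE_turns (A # (A + (0, 1)) # Q) = NE_turns ((A + (0, 1)) # Q)"
proof -
  assume "Q \<in> lattice_paths (A + (0, 2)) E"
  then obtain Q' where "Q = (A + (0, 2)) # Q'" using lattice_paths_hd by blast
  then show ?thesis by (cases A) (auto simp: NE_turns_short NE_turns_Cons horizontal_step_def)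
qed

lemma NE_turns_turn: "Q \<in> lattice_paths (A + (1, 1)) E \<Longrightarrow>
    NE_turns (A # (A + (0, 1)) # Q) = insert (A + (0, 1)) (NE_turns Q)"
proof -
  assume Q: "Q \<in> lattice_paths (A + (1, 1)) E"
  then obtain Q' where Q': "Q = (A + (1, 1)) # Q'" using lattice_paths_hd by blast
  have "NE_turns ((A + (0, 1)) # Q) = NE_turns Q"
    using NE_turns_right[of Q "A + (0, 1)" E] Q by (simp add: add.assoc)
  then show ?thesis using Q'
    by (cases A) (auto simp: NE_turns_Cons horizontal_step_def vertical_step_def)
qed

text \<open>A path is built from its end, where an up step that is followed by a step to the right is added
together with it. So the case distinction tells whether a new NE-turn arises.\<close>
lemma lattice_paths_induct [consumes 1, case_names point right up turn]:
  assumes "P \<in> lattice_paths A E"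
    and "\<Phi> E [E]"
    and "\<And>A Q. Q \<in> lattice_paths (A + (1, 0)) E \<Longrightarrow> \<Phi> (A + (1, 0)) Q \<Longrightarrow> \<Phi> A (A # Q)"
    and "\<And>A Q. (A + (0, 1)) # Q \<in> lattice_paths (A + (0, 1)) E \<Longrightarrow>
      Q = [] \<and> A + (0, 1) = E \<or> Q \<in> lattice_paths (A + (0, 2)) E \<Longrightarrow>
      \<Phi> (A + (0, 1)) ((A + (0, 1)) # Q) \<Longrightarrow> \<Phi> A (A # (A + (0, 1)) # Q)"
    and "\<And>A Q. Q \<in> lattice_paths (A + (1, 1)) E \<Longrightarrow> \<Phi> (A + (1, 1)) Q \<Longrightarrow>
      \<Phi> A (A # (A + (0, 1)) # Q)"
  shows "\<Phi> A P"
  using assms(1)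
proof (induction "length P" arbitrary: A P rule: less_induct)
  case less
  note IH = less.hyps
  from less.prems consider "P = [A]" "A = E"
    | Q where "P = A # Q" "Q \<in> lattice_paths (A + (1, 0)) E"
    | Q where "P = A # Q" "Q \<in> lattice_paths (A + (0, 1)) E"
    by (subst (asm) lattice_paths_iff) auto
  then show ?case
  proof cases
    case 1
    then show ?thesis using assms(2) by simp
  next
    case 2
    then show ?thesis using assms(3)[OF 2(2)] IH by simp
  next
    case 3
    then obtain Q' where Q: "Q = (A + (0, 1)) # Q'" using lattice_paths_hd by blast
    have "Q' = [] \<and> A + (0, 1) = E \<or> Q' \<in> lattice_paths (A + (1, 1)) E \<or> Q' \<in> lattice_paths (A + (0, 2)) E"
      using 3(2) unfolding Q by (subst (asm) lattice_paths_iff) (auto simp: add.assoc)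
    then show ?thesis
      using 3 Q IH[of Q "A + (0, 1)"] IH[of Q' "A + (1, 1)"] assms(4)[of A Q'] assms(5)[of Q' A] by auto
  qed
qed

lemma below_insert: "finite S \<Longrightarrow> a \<notin> S \<Longrightarrow> below (insert a S) x = below S x + of_bool (a < x)"
proof -
  assume S: "finite S" "a \<notin> S"
  have "{b \<in> insert a S. b < x} = (if a < x then insert a {b \<in> S. b < x} else {b \<in> S. b < x})" by auto
  with S show ?thesis by (simp add: below_def)
qed

lemma below_pos: "finite S \<Longrightarrow> a \<in> S \<Longrightarrow> a < x \<Longrightarrow> 1 \<le> below S x"
  using below_mono[of S "a + 1" x] below_plus_one[of S a] below_nonneg[of S a] by simp

definition turn_rows :: "point list \<Rightarrow> rows" where
  "turn_rows P = (fst ` NE_turns P, snd ` NE_turns P)"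

text \<open>With \<open>a\<^sub>1 < \<dots> < a\<^sub>k\<close> in the first and \<open>b\<^sub>1 < \<dots> < b\<^sub>k\<close> in the second row, a path with these NE-turns
occupies in the column \<open>x\<close> the levels from \<open>b\<^sub>p\<close> to \<open>b\<^sub>q\<close>, where \<open>p\<close> entries of the first row
are less than \<open>x\<close> and \<open>q\<close> are at most \<open>x\<close>. Here \<open>b\<^sub>0\<close> is the level of the start \<open>A\<close>, and the
last column extends up to the end \<open>E\<close>; these exceptions are the two equations in the last line.\<close>
definition path_points :: "point \<Rightarrow> point \<Rightarrow> rows \<Rightarrow> point set" where
  "path_points A E T = {(x, y). fst A \<le> x \<and> x \<le> fst E \<and> snd A \<le> y \<and> y \<le> snd E \<and>
     below (fst T) x \<le> below (snd T) (y + 1) \<and>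
     (x = fst E \<or> y = snd A \<or> below (snd T) y < below (fst T) (x + 1))}"

lemma lattice_path_rows:
  assumes "P \<in> lattice_paths A E"
  shows "fst A \<le> fst E" "snd A \<le> snd E"
    and "finite (NE_turns P)"
    and "fst (turn_rows P) \<subseteq> {fst A..<fst E}" "snd (turn_rows P) \<subseteq> {snd A<..snd E}"
    and "card (fst (turn_rows P)) = NE P" "card (snd (turn_rows P)) = NE P"
    and "set P = path_points A E (turn_rows P)"
proof -
  \<comment> \<open>The last conjunct says that a path that starts upwards has its first turn in its first column,
    unless it ends there; without it the up step could not be added.\<close>
  let ?\<Phi> = "\<lambda>A P. fst A \<le> fst E \<and> snd A \<le> snd E \<and> finite (NE_turns P) \<and>
    fst (turn_rows P) \<subseteq> {fst A..<fst E} \<and> snd (turn_rows P) \<subseteq> {snd A<..snd E} \<and>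
    card (fst (turn_rows P)) = NE P \<and> card (snd (turn_rows P)) = NE P \<and>
    set P = path_points A E (turn_rows P) \<and>
    (P = [E] \<or> (\<exists>Q. P = A # Q \<and> Q \<in> lattice_paths (A + (0, 1)) E) \<longrightarrow>
      fst A = fst E \<or> fst A \<in> fst (turn_rows P))"
  have "?\<Phi> A P"
    using assms
  proof (induction rule: lattice_paths_induct)
    case point
    then show ?case
      by (auto simp: turn_rows_def NE_turns_short NE_def path_points_def below_def)
  next
    case (right A Q)
    obtain a1 a2 where A: "A = (a1, a2)" by (cases A)
    have T: "turn_rows (A # Q) = turn_rows Q" "NE (A # Q) = NE Q" "NE_turns (A # Q) = NE_turns Q"
      using NE_turns_right[OF right(1)] by (simp_all add: turn_rows_def NE_def)
    obtain S R where SR: "turn_rows Q = (S, R)" by (cases "turn_rows Q")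
    have S: "below S a1 = 0" "below S (a1 + 1) = 0" and R: "below R (a2 + 1) = 0" "below R a2 = 0"
      using right(2) SR A by (auto intro!: below_eq_0)
    have "path_points A E (S, R) = insert A (path_points (A + (1, 0)) E (S, R))"
    proof (intro equalityI subsetI)
      fix p assume "p \<in> path_points A E (S, R)"
      moreover obtain x y where p: "p = (x, y)" by (cases p)
      ultimately show "p \<in> insert A (path_points (A + (1, 0)) E (S, R))"
        using S right(2) below_nonneg[of R y] by (cases "x = a1") (auto simp: A path_points_def)
    next
      fix p assume "p \<in> insert A (path_points (A + (1, 0)) E (S, R))"
      moreover obtain x y where p: "p = (x, y)" by (cases p)
      ultimately show "p \<in> path_points A E (S, R)"
        using S R right(2) by (auto simp: A path_points_def)
    qed
    moreover have "set Q = path_points (A + (1, 0)) E (S, R)"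
      using right(2) by (simp add: SR)
    ultimately have set: "set (A # Q) = path_points A E (S, R)" by simp
    have "\<not> (A # Q = [E] \<or> (\<exists>Q'. A # Q = A # Q' \<and> Q' \<in> lattice_paths (A + (0, 1)) E))"
      using lattice_paths_hd[of Q "A + (0, 1)" E] lattice_paths_hd[OF right(1)] A by auto
    moreover have "fst A \<le> fst E" "snd A \<le> snd E" "finite (NE_turns Q)" "S \<subseteq> {fst A..<fst E}"
      "R \<subseteq> {snd A<..snd E}" "card S = NE Q" "card R = NE Q"
      using right(2) unfolding SR by (auto simp: A)
    ultimately show ?case unfolding T SR fst_conv snd_conv using set by blast
  next
    case (up A Q)
    obtain a1 a2 where A: "A = (a1, a2)" by (cases A)
    let ?Q = "(A + (0, 1)) # Q"
    have N: "NE_turns (A # ?Q) = NE_turns ?Q"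
      using up(2) NE_turns_up[of Q A E] by (auto simp: NE_turns_short)
    have T: "turn_rows (A # ?Q) = turn_rows ?Q" "NE (A # ?Q) = NE ?Q"
      using N by (simp_all add: turn_rows_def NE_def)
    obtain S R where SR: "turn_rows ?Q = (S, R)" by (cases "turn_rows ?Q")
    have IH: "a1 \<le> fst E" "a2 + 1 \<le> snd E" "finite (NE_turns ?Q)" "S \<subseteq> {a1..<fst E}"
      "R \<subseteq> {a2 + 1<..snd E}" "card S = NE ?Q" "card R = NE ?Q"
      "set ?Q = path_points (A + (0, 1)) E (S, R)"
      using up(3) unfolding SR by (auto simp: A)
    have start: "a1 = fst E \<or> a1 \<in> S"
      using up(2,3) unfolding SR by (auto simp: A add.assoc)
    have fin: "finite S" using IH by (auto intro: finite_subset)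
    have S: "below S a1 = 0" and R: "below R (a2 + 1) = 0" "below R a2 = 0"
      using IH by (auto intro!: below_eq_0)
    have pos: "1 \<le> below S x" if "a1 < x" "x \<le> fst E \<or> a1 \<noteq> fst E" for x
      using below_pos[OF fin, of a1] start that by auto
    obtain e1 e2 where E: "E = (e1, e2)" by (cases E)
    have e: "a1 \<le> e1" "a2 + 1 \<le> e2" using IH by (auto simp: E)
    have "(x, y) \<in> path_points (a1, a2) (e1, e2) (S, R) \<longleftrightarrow>
        x = a1 \<and> y = a2 \<or> (x, y) \<in> path_points (a1, a2 + 1) (e1, e2) (S, R)" for x y
    proof -
      consider "y = a2" "x = a1" | "y = a2" "a1 < x" "x \<le> e1" | "y = a2" "x < a1 \<or> e1 < x"
        | "y = a2 + 1" "a1 \<le> x" "x < e1" | "y = a2 + 1" "x < a1 \<or> e1 \<le> x" | "y < a2" | "a2 + 1 < y"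
        by linarith
      then show ?thesis
      proof cases
        case 1
        then show ?thesis using S R e by (simp add: path_points_def)
      next
        case 2
        then show ?thesis using pos[of x] R by (simp add: path_points_def E)
      next
        case 4
        then show ?thesis using pos[of "x + 1"] R by (simp add: path_points_def E)
      qed (use e in \<open>auto simp: path_points_def\<close>)
    qed
    then have "path_points A E (S, R) = insert A (path_points (A + (0, 1)) E (S, R))"
      unfolding A E by auto
    then have "set (A # ?Q) = path_points A E (S, R)" using IH(8) by simp
    moreover have "fst A \<le> fst E" "snd A \<le> snd E" "S \<subseteq> {fst A..<fst E}" "R \<subseteq> {snd A<..snd E}"
      "fst A = fst E \<or> fst A \<in> S"
      using IH start by (auto simp: A)
    ultimately show ?case unfolding T SR N fst_conv snd_conv using IH(3,6,7) by blast
  next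
    case (turn A Q)
    obtain a1 a2 where A: "A = (a1, a2)" by (cases A)
    let ?P = "A # (A + (0, 1)) # Q"
    obtain S R where SR: "turn_rows Q = (S, R)" by (cases "turn_rows Q")
    have N: "NE_turns ?P = insert (a1, a2 + 1) (NE_turns Q)"
      using NE_turns_turn[OF turn(1)] by (simp add: A)
    then have T: "turn_rows ?P = (insert a1 S, insert (a2 + 1) R)"
      using SR by (simp add: turn_rows_def)
    have IH: "a1 + 1 \<le> fst E" "a2 + 1 \<le> snd E" "finite (NE_turns Q)" "S \<subseteq> {a1 + 1..<fst E}"
      "R \<subseteq> {a2 + 1<..snd E}" "card S = NE Q" "card R = NE Q" "set Q = path_points (a1 + 1, a2 + 1) E (S, R)"
      using turn(2) unfolding SR by (auto simp: A)
    have fin: "finite S" "finite R" using SR IH(3) by (auto simp: turn_rows_def)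
    have new: "a1 \<notin> S" "a2 + 1 \<notin> R" using IH by auto
    have "(a1, a2 + 1) \<notin> NE_turns Q" using new SR by (force simp: turn_rows_def)
    then have NE: "NE ?P = Suc (NE Q)" using IH(3) by (simp add: NE_def N)
    have cS: "below (insert a1 S) x = below S x + of_bool (a1 < x)"
      and cR: "below (insert (a2 + 1) R) x = below R x + of_bool (a2 + 1 < x)" for x
      using below_insert[OF fin(1) new(1)] below_insert[OF fin(2) new(2)] by simp_all
    have S0: "below S x = 0" if "x \<le> a1 + 1" for x using IH that by (auto intro!: below_eq_0)
    have R0: "below R x = 0" if "x \<le> a2 + 2" for x using IH that by (auto intro!: below_eq_0)
    obtain e1 e2 where E: "E = (e1, e2)" by (cases E)
    have e: "a1 + 1 \<le> e1" "a2 + 1 \<le> e2" using IH by (auto simp: E)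
    have "(x, y) \<in> path_points (a1, a2) (e1, e2) (insert a1 S, insert (a2 + 1) R) \<longleftrightarrow>
        x = a1 \<and> y = a2 \<or> x = a1 \<and> y = a2 + 1 \<or>
        (x, y) \<in> path_points (a1 + 1, a2 + 1) (e1, e2) (S, R)" for x y
    proof -
      consider "x < a1 \<or> y < a2" | "x = a1" "a2 \<le> y" | "a1 < x" "y = a2" | "a1 < x" "y = a2 + 1"
        | "a1 < x" "a2 + 1 < y"
        by linarith
      then show ?thesis
      proof cases
        case 2
        then show ?thesis
          using S0[of a1] S0[of "a1 + 1"] R0[of y] below_nonneg[of R y] below_nonneg[of R "y + 1"] e
          by (auto simp: path_points_def cS cR of_bool_def)
      next
        case 3
        then show ?thesis
          using R0[of "a2 + 1"] below_nonneg[of S x] by (auto simp: path_points_def cS cR)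
      next
        case 4
        then show ?thesis
          using R0[of "a2 + 1"] below_nonneg[of S "x + 1"] by (auto simp: path_points_def cS cR)
      next
        case 5
        then show ?thesis by (auto simp: path_points_def cS cR)
      qed (auto simp: path_points_def)
    qed
    then have "path_points A E (insert a1 S, insert (a2 + 1) R) =
      insert A (insert (a1, a2 + 1) (path_points (a1 + 1, a2 + 1) E (S, R)))"
      unfolding A E by auto
    then have "set ?P = path_points A E (insert a1 S, insert (a2 + 1) R)" using IH(8) by (simp add: A)
    moreover have "fst A \<le> fst E" "snd A \<le> snd E" "insert a1 S \<subseteq> {fst A..<fst E}"
      "insert (a2 + 1) R \<subseteq> {snd A<..snd E}" "fst A \<in> insert a1 S"
      using IH by (auto simp: A)
    moreover have "finite (NE_turns ?P)" "card (insert a1 S) = NE ?P" "card (insert (a2 + 1) R) = NE ?P"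
      using IH fin new by (simp_all add: N NE)
    ultimately show ?case unfolding T fst_conv snd_conv by blast
  qed
  then show "fst A \<le> fst E" "snd A \<le> snd E" "finite (NE_turns P)"
    "fst (turn_rows P) \<subseteq> {fst A..<fst E}" "snd (turn_rows P) \<subseteq> {snd A<..snd E}"
    "card (fst (turn_rows P)) = NE P" "card (snd (turn_rows P)) = NE P"
    "set P = path_points A E (turn_rows P)"
    by blast+
qed

lemma lattice_path_eq_if_set_eq:
  assumes "lattice_path P" "lattice_path Q" "set P = set Q"
  shows "P = Q"
proof -
  let ?k = "\<lambda>p :: point. fst p + snd p"
  have *: "sorted_wrt (<) (map ?k P)" if "lattice_path P" for P
  proof -
    have "successively (\<lambda>p q. ?k p < ?k q) P"
      using that unfolding lattice_path_def
      by (auto elim!: successively_mono simp: horizontal_step_def vertical_step_def)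
    then show ?thesis
      by (subst (asm) successively_conv_sorted_wrt) (auto intro: transpI simp: sorted_wrt_map)
  qed
  have "inj_on ?k (set P \<union> set Q)"
    using *[OF assms(1)] assms(3) by (simp add: strict_sorted_iff distinct_map)
  then show ?thesis
    using *[OF assms(1)] *[OF assms(2)] assms(3)
    by (intro map_sorted_distinct_set_unique) (auto simp: strict_sorted_iff)
qed

text \<open>The turns determine the set of points, and the points occur in the order of their coordinate sums.\<close>
lemma turn_rows_inj: "inj_on turn_rows (lattice_paths A E)"
proof (rule inj_onI)
  fix P Q assume "P \<in> lattice_paths A E" "Q \<in> lattice_paths A E" "turn_rows P = turn_rows Q"
  then show "P = Q"
    using lattice_path_rows(8)[of P A E] lattice_path_rows(8)[of Q A E]
    by (intro lattice_path_eq_if_set_eq) (auto simp: lattice_paths_def)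
qed

text \<open>The path goes to the right until it reaches the smallest element of \<open>S\<close>, then upwards to
the smallest element of \<open>R\<close>, and continues from there with the remaining elements.\<close>
lemma turn_rows_surj:
  assumes "fst A \<le> fst E" "snd A \<le> snd E" "S \<subseteq> {fst A..<fst E}" "R \<subseteq> {snd A<..snd E}" "card S = card R"
  shows "\<exists>P\<in>lattice_paths A E. turn_rows P = (S, R)"
  using assms
proof (induction "nat (fst E - fst A + snd E - snd A)" arbitrary: A S R rule: less_induct)
  case less
  note IH = less.hyps and pre = less.prems
  obtain a1 a2 where A: "A = (a1, a2)" by (cases A)
  have fin: "finite S" "finite R" using pre by (auto intro: finite_subset)
  consider "A = E" | "a1 < fst E" "a1 \<notin> S" | "a1 \<in> S" "a2 + 1 \<in> R" | "a1 \<in> S" "a2 + 1 \<notin> R"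
    | "a1 = fst E" "a2 < snd E"
    using pre A by (cases E) fastforce
  then show ?case
  proof cases
    case 1
    then have "S = {}" "R = {}" using pre by auto
    then have "turn_rows [A] = (S, R)" by (simp add: turn_rows_def NE_turns_short)
    moreover have "[A] \<in> lattice_paths A E" using 1 by (subst lattice_paths_iff) simp
    ultimately show ?thesis by blast
  next
    case 2
    have "\<exists>Q\<in>lattice_paths (A + (1, 0)) E. turn_rows Q = (S, R)"
      using pre 2 A by (intro IH) (auto simp: order_le_less)
    then obtain Q where Q: "Q \<in> lattice_paths (A + (1, 0)) E" "turn_rows Q = (S, R)" by blast
    have "A # Q \<in> lattice_paths A E" using Q by (subst lattice_paths_iff) simp
    moreover have "turn_rows (A # Q) = (S, R)" using Q NE_turns_right[OF Q(1)] by (simp add: turn_rows_def)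
    ultimately show ?thesis by blast
  next
    case 3
    have "\<exists>Q\<in>lattice_paths (A + (1, 1)) E. turn_rows Q = (S - {a1}, R - {a2 + 1})"
    proof (rule IH)
      show "fst (A + (1, 1)) \<le> fst E" "snd (A + (1, 1)) \<le> snd E"
        using pre(3,4) 3 by (auto simp: A)
      then show "nat (fst E - fst (A + (1, 1)) + snd E - snd (A + (1, 1))) < nat (fst E - fst A + snd E - snd A)"
        by (simp add: A)
      show "S - {a1} \<subseteq> {fst (A + (1, 1))..<fst E}"
        using pre(3) by (auto simp: A order_le_less[of a1])
      show "R - {a2 + 1} \<subseteq> {snd (A + (1, 1))<..snd E}"
        using pre(4) by (auto simp: A order_le_less[of "a2 + 1"])
      show "card (S - {a1}) = card (R - {a2 + 1})"
        using pre(5) 3 fin by simp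
    qed
    then obtain Q where Q: "Q \<in> lattice_paths (A + (1, 1)) E" "turn_rows Q = (S - {a1}, R - {a2 + 1})" by blast
    have "(A + (0, 1)) # Q \<in> lattice_paths (A + (0, 1)) E"
      using Q by (subst lattice_paths_iff) (simp add: add.assoc)
    then have "A # (A + (0, 1)) # Q \<in> lattice_paths A E" by (subst lattice_paths_iff) simp
    moreover have "turn_rows (A # (A + (0, 1)) # Q) = (S, R)"
      using Q NE_turns_turn[OF Q(1)] 3 A by (auto simp: turn_rows_def)
    ultimately show ?thesis by blast
  next
    case 4
    then have "R \<noteq> {}" using pre fin by auto
    then have a2: "a2 + 1 \<le> snd E" using pre A by fastforce
    have "\<exists>Q\<in>lattice_paths (A + (0, 1)) E. turn_rows Q = (S, R)"
    proof (rule IH)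
      show "fst (A + (0, 1)) \<le> fst E" "snd (A + (0, 1)) \<le> snd E"
        using pre(1) a2 by (auto simp: A)
      then show "nat (fst E - fst (A + (0, 1)) + snd E - snd (A + (0, 1))) < nat (fst E - fst A + snd E - snd A)"
        by (simp add: A)
      show "S \<subseteq> {fst (A + (0, 1))..<fst E}" "card S = card R"
        using pre(3,5) by (simp_all add: A)
      show "R \<subseteq> {snd (A + (0, 1))<..snd E}"
      proof
        fix y assume "y \<in> R"
        then have "a2 < y" "y \<le> snd E" "y \<noteq> a2 + 1" using pre(4) 4 by (auto simp: A)
        then show "y \<in> {snd (A + (0, 1))<..snd E}" by (simp add: A)
      qed
    qed
    then obtain Q where Q: "Q \<in> lattice_paths (A + (0, 1)) E" "turn_rows Q = (S, R)" by blast
    then obtain Q' where Q': "Q = (A + (0, 1)) # Q'" using lattice_paths_hd by blast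
    have "Q' \<notin> lattice_paths (A + (0, 1) + (1, 0)) E"
    proof
      assume R: "Q' \<in> lattice_paths (A + (0, 1) + (1, 0)) E"
      then have "fst (turn_rows Q') \<subseteq> {a1 + 1..<fst E}" using lattice_path_rows(4)[OF R] A by simp
      moreover have "turn_rows Q' = (S, R)"
        using NE_turns_right[OF R] Q Q' by (simp add: turn_rows_def)
      ultimately show False using 4 by auto
    qed
    moreover have "Q' \<noteq> []" using Q Q' 4 by (auto simp: turn_rows_def NE_turns_short)
    ultimately have "Q' \<in> lattice_paths (A + (0, 2)) E"
      using Q(1) unfolding Q' by (subst (asm) lattice_paths_iff) (auto simp: add.assoc)
    then have "turn_rows (A # Q) = (S, R)"
      using Q NE_turns_up[of Q' A E] by (simp add: turn_rows_def Q')
    moreover have "A # Q \<in> lattice_paths A E" using Q by (subst lattice_paths_iff) simp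
    ultimately show ?thesis by blast
  next
    case 5
    then have e: "S = {}" "R = {}" using pre A fin by auto
    have "\<exists>Q\<in>lattice_paths (A + (0, 1)) E. turn_rows Q = ({}, {})"
      using pre 5 A by (intro IH) auto
    then obtain Q where Q: "Q \<in> lattice_paths (A + (0, 1)) E" "turn_rows Q = ({}, {})" by blast
    then obtain Q' where Q': "Q = (A + (0, 1)) # Q'" using lattice_paths_hd by blast
    have "Q' \<notin> lattice_paths (A + (0, 1) + (1, 0)) E"
      using lattice_path_rows(1)[of Q' "A + (0, 1) + (1, 0)" E] 5 A by auto
    then have "Q' = [] \<or> Q' \<in> lattice_paths (A + (0, 2)) E"
      using Q(1) unfolding Q' by (subst (asm) lattice_paths_iff) (auto simp: add.assoc)
    then have "turn_rows (A # Q) = (S, R)"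
      using Q NE_turns_up[of Q' A E] by (auto simp: turn_rows_def Q' e NE_turns_short)
    moreover have "A # Q \<in> lattice_paths A E" using Q by (subst lattice_paths_iff) simp
    ultimately show ?thesis by blast
  qed
qed

section \<open>Two-rowed arrays and the ladder condition\<close>
lemma below_nth:
  assumes "sorted_wrt (<) xs" "j < length xs"
  shows "int j < below (set xs) v \<longleftrightarrow> xs ! j < v"
proof -
  have mono: "xs ! i \<le> xs ! k" if "i \<le> k" "k < length xs" for i k
    using assms(1) that by (intro sorted_nth_mono) (auto simp: strict_sorted_iff)
  let ?I = "{i. i < length xs \<and> xs ! i < v}"
  have "{x \<in> set xs. x < v} = (!) xs ` ?I" by (auto simp: in_set_conv_nth)
  moreover have "inj_on ((!) xs) ?I"
    using assms(1) by (auto simp: strict_sorted_iff intro!: inj_on_nth)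
  ultimately have I: "below (set xs) v = int (card ?I)" by (simp add: below_def card_image)
  show ?thesis
  proof
    assume "xs ! j < v"
    then have "{..j} \<subseteq> ?I" using assms(2) mono[of _ j] by (auto intro: le_less_trans)
    then have "card {..j} \<le> card ?I" by (intro card_mono) auto
    then show "int j < below (set xs) v" by (simp add: I)
  next
    assume less: "int j < below (set xs) v"
    show "xs ! j < v"
    proof (rule ccontr)
      assume neg: "\<not> xs ! j < v"
      have "i < j" if "i \<in> ?I" for i
        using mono[of j i] neg that by (cases "i < j") auto
      then have "?I \<subseteq> {..<j}" by auto
      then have "card ?I \<le> card {..<j}" by (intro card_mono) auto
      with less show False by (simp add: I)
    qed
  qed
qed

lemma below_at_nth:
  assumes "sorted_wrt (<) xs" "j < length xs"
  shows "below (set xs) (xs ! j) = int j"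
proof -
  have "\<not> int j < below (set xs) (xs ! j)" using below_nth[OF assms] by simp
  moreover have "int j \<le> below (set xs) (xs ! j)"
  proof (cases j)
    case (Suc k)
    then have "xs ! k < xs ! j" using assms by (auto simp: sorted_wrt_iff_nth_less)
    then have "int k < below (set xs) (xs ! j)" using below_nth[OF assms(1), of k] Suc assms by simp
    then show ?thesis using Suc by simp
  qed (simp add: below_nonneg)
  ultimately show ?thesis by simp
qed

lemma element_of_rank:
  assumes "finite S" "0 \<le> m" "m < int (card S)"
  obtains s where "s \<in> S" "below S s = m"
proof -
  define xs where "xs = sorted_list_of_set S"
  have xs: "sorted_wrt (<) xs" "set xs = S" "nat m < length xs"
    using assms by (auto simp: xs_def)
  then have "xs ! nat m \<in> S" "below S (xs ! nat m) = m"
    using below_at_nth[of xs "nat m"] nth_mem[of "nat m" xs] assms(2) by auto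
  with that show thesis .
qed

context ladder_rows
begin

text \<open>Only the points \<open>x\<close> in the first row matter, because the height along the boundary can decrease
only there, and the entry \<open>bs ! j\<close> of the second row is below a bound if and only if more than
\<open>j\<close> entries are.\<close>
lemma in_ladder_iff_nth:
  assumes sorted: "sorted_wrt (<) as" "sorted_wrt (<) bs" and len: "length as + i = length bs + u"
  shows "in_ladder u (set as, set bs) \<longleftrightarrow> (\<forall>j<length as. u \<le> j \<longrightarrow> bs ! (j - u) < g (as ! j))"
proof
  assume lad: "in_ladder u (set as, set bs)"
  show "\<forall>j<length as. u \<le> j \<longrightarrow> bs ! (j - u) < g (as ! j)"
  proof (intro allI impI)
    fix j assume j: "j < length as" "u \<le> j"
    have "0 \<le> height u (set as, set bs) (as ! j + 1) (g (as ! j))"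
      using lad by (simp add: in_ladder_def)
    then have "int (j - u) < below (set bs) (g (as ! j))"
      using j below_at_nth[OF sorted(1) j(1)] by (simp add: height_def below_plus_one)
    moreover have "j - u < length bs" using j len by linarith
    ultimately show "bs ! (j - u) < g (as ! j)"
      using below_nth[OF sorted(2), of "j - u" "g (as ! j)"] by simp
  qed
next
  assume *: "\<forall>j<length as. u \<le> j \<longrightarrow> bs ! (j - u) < g (as ! j)"
  show "in_ladder u (set as, set bs)"
    unfolding in_ladder_def
  proof
    fix x
    show "0 \<le> height u (set as, set bs) (x + 1) (g x)"
    proof (cases "below (set as) (x + 1) \<le> int u")
      case True
      then show ?thesis using below_nonneg[of "set bs" "g x"] by (simp add: height_def)
    next
      case False
      define j where "j = nat (below (set as) (x + 1) - 1)"
      have j: "below (set as) (x + 1) = int j + 1" "u \<le> j" using False by (auto simp: j_def)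
      have "int j < int (length as)"
        using j below_le_card[of "set as" "x + 1"] card_length[of as] by simp
      then have len_j: "j < length as" by simp
      have "as ! j < x + 1" using below_nth[OF sorted(1) len_j, of "x + 1"] j by simp
      then have "g (as ! j) \<le> g x" by (intro g_mono) simp
      moreover have "bs ! (j - u) < g (as ! j)" using * len_j j by simp
      ultimately have "bs ! (j - u) < g x" by simp
      then have "int (j - u) < below (set bs) (g x)"
        using below_nth[OF sorted(2), of "j - u" "g x"] len_j j(2) len by simp
      then show ?thesis using j by (simp add: height_def)
    qed
  qed
qed

lemma TA_ladder_iff:
  assumes "length as + i = length bs + u"
  shows "(\<forall>s. s \<in> {1..int (length bs)} \<and> s + int i \<in> {- (int u - int i) + 1..int (length bs)} \<longrightarrow>
      second_row (as, bs) s < f (first_row (int u - int i) (as, bs) (s + int i))) \<longleftrightarrow>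
    (\<forall>j<length as. u \<le> j \<longrightarrow> bs ! (j - u) < f (as ! j))"
proof (intro iffI allI impI)
  fix j
  assume *: "\<forall>s. s \<in> {1..int (length bs)} \<and> s + int i \<in> {- (int u - int i) + 1..int (length bs)} \<longrightarrow>
      second_row (as, bs) s < f (first_row (int u - int i) (as, bs) (s + int i))"
    and j: "j < length as" "u \<le> j"
  have "second_row (as, bs) (int j - int u + 1) <
      f (first_row (int u - int i) (as, bs) (int j - int u + 1 + int i))"
    using j assms by (intro *[rule_format]) auto
  moreover have "nat (int j - int u) = j - u" using j by simp
  ultimately show "bs ! (j - u) < f (as ! j)" by (simp add: second_row_def first_row_def)
next
  fix s
  assume *: "\<forall>j<length as. u \<le> j \<longrightarrow> bs ! (j - u) < f (as ! j)"
    and s: "s \<in> {1..int (length bs)} \<and> s + int i \<in> {- (int u - int i) + 1..int (length bs)}"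
  define j where "j = nat (s + int u - 1)"
  have j: "s = int j - int u + 1" "u \<le> j" using s by (auto simp: j_def)
  moreover have "j < length as" using j s assms by auto
  ultimately have "bs ! (j - u) < f (as ! j)" using * by blast
  moreover have "nat (int j - int u) = j - u" using j by simp
  ultimately show "second_row (as, bs) s < f (first_row (int u - int i) (as, bs) (s + int i))"
    by (simp add: second_row_def first_row_def j(1))
qed

lemma sum_TA:
  assumes f: "\<And>x. x < \<epsilon> i \<Longrightarrow> f x = g x"
  shows "(\<Sum>T\<in>TA (int u - int i) (\<alpha> u, \<beta> u) (\<epsilon> i - 1, \<delta> i - 1) f (int i). w (array_size T)) =
    (\<Sum>U\<in>entry u i. w (rows_size U))"
proof -
  let ?TA = "TA (int u - int i) (\<alpha> u, \<beta> u) (\<epsilon> i - 1, \<delta> i - 1) f (int i)"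
  let ?list = "sorted_list_of_set :: int set \<Rightarrow> int list"
  have TA: "(as, bs) \<in> ?TA \<longleftrightarrow> sorted_wrt (<) as \<and> sorted_wrt (<) bs \<and> (set as, set bs) \<in> entry u i"
    for as bs
  proof (cases "sorted_wrt (<) as \<and> sorted_wrt (<) bs")
    case True
    then have card: "card (set as) = length as" "card (set bs) = length bs"
      by (auto simp: strict_sorted_iff distinct_card)
    have len: "int (length as) = int (length bs) + (int u - int i) \<longleftrightarrow> length as + i = length bs + u"
      by linarith
    have "f (as ! j) = g (as ! j)" if "set as \<subseteq> {\<alpha> u..<\<epsilon> i}" "j < length as" for j
    proof (rule f)
      show "as ! j < \<epsilon> i" using that nth_mem[of j as] by fastforce
    qed
    note fg = this
    have iv: "{\<alpha> u..\<epsilon> i - 1} = {\<alpha> u..<\<epsilon> i}" "{\<beta> u..\<delta> i - 1} = {\<beta> u..<\<delta> i}" by auto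
    show ?thesis
      using True TA_ladder_iff[of as i bs u f] in_ladder_iff_nth[of as bs i u] fg
      by (auto simp: TA_def array_of_type_def entry_def arrays_def iv card len simp del: atLeastAtMost_iff)
  qed (auto simp: TA_def array_of_type_def)
  show ?thesis
  proof (rule sum.reindex_bij_witness[of _ "\<lambda>(S, R). (?list S, ?list R)" "\<lambda>(as, bs). (set as, set bs)"])
    fix T assume T: "T \<in> ?TA"
    obtain as bs where [simp]: "T = (as, bs)" by (cases T)
    have s: "sorted_wrt (<) as" "sorted_wrt (<) bs" using T TA by auto
    then show "(case case T of (as, bs) \<Rightarrow> (set as, set bs) of (S, R) \<Rightarrow> (?list S, ?list R)) = T"
      by (auto simp: strict_sorted_iff sorted_list_of_set.idem_if_sorted_distinct)
    show "(case T of (as, bs) \<Rightarrow> (set as, set bs)) \<in> entry u i" using T TA by auto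
    show "w (rows_size (case T of (as, bs) \<Rightarrow> (set as, set bs))) = w (array_size T)"
      using s by (simp add: rows_size_def array_size_def strict_sorted_iff distinct_card)
  next
    fix U assume U: "U \<in> entry u i"
    obtain S R where [simp]: "U = (S, R)" by (cases U)
    have fin: "finite S" "finite R" using U finite_rows_arrays[of U u i] by (auto simp: entry_def)
    then show "(case case U of (S, R) \<Rightarrow> (?list S, ?list R) of (as, bs) \<Rightarrow> (set as, set bs)) = U" by simp
    show "(case U of (S, R) \<Rightarrow> (?list S, ?list R)) \<in> ?TA" using U fin by (simp add: TA)
  qed
qed

text \<open>In a family without crossings every array is below the first one, from which it inherits the
ladder condition up to the first end point.\<close>
lemma in_ladder_if_uncrossed:
  assumes cfg: "config id T" and none: "\<And>i x z. \<not> crossing id T i x z"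
    and lad: "in_ladder 0 (T 0)" and i: "i < n"
  shows "in_ladder i (T i)"
  unfolding in_ladder_def
proof
  fix x
  have arr: "T r \<in> arrays r r" if "r < n" for r using cfg that by (auto simp: config_def)
  show "0 \<le> height i (T i) (x + 1) (g x)"
  proof (cases "\<epsilon> 0 \<le> x")
    case True
    then show ?thesis by (rule height_ladder_past_end[OF arr[OF i] i])
  next
    case False
    show ?thesis
    proof (rule ccontr)
      assume neg: "\<not> 0 \<le> height i (T i) (x + 1) (g x)"
      have \<beta>: "\<beta> r \<le> g x" if "r < n" for r using \<beta>_antimono[of 0 r] g_ge[of x] that by simp
      have "\<alpha> i \<le> x + 1" using height_at_start[OF arr[OF i], of "x + 1" "g x"] neg by linarith
      have "height (id 0) (T 0) (x + 1) (g x) < int 0"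
      proof (rule height_chain[OF cfg none, of i])
        show "\<alpha> (id i) \<le> x + 1" using \<open>\<alpha> i \<le> x + 1\<close> by simp
        show "height (id i) (T i) (x + 1) (g x) < int i" using neg by simp
        show "x + 1 \<le> \<epsilon> r \<and> \<beta> (id r) \<le> g x \<and> (id r < r \<longrightarrow> \<alpha> (id r) \<le> x + 1)" if "r < i" for r
          using that i False \<epsilon>_mono[of 0 r] \<beta>[of r] by simp
      qed (use i \<beta> in simp_all)
      moreover have "0 \<le> height 0 (T 0) (x + 1) (g x)" using lad unfolding in_ladder_def by blast
      ultimately show False by simp
    qed
  qed
qed

end

section \<open>Nonintersecting families of paths\<close>
definition shifted :: "int \<Rightarrow> rows \<Rightarrow> rows" where
  "shifted k T = ((\<lambda>x. x - k) ` fst T, (\<lambda>y. y + k) ` snd T)"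

lemma below_shift: "below ((\<lambda>x. x + k) ` S) y = below S (y - k)"
proof -
  have "{a \<in> (\<lambda>x. x + k) ` S. a < y} = (\<lambda>x. x + k) ` {a \<in> S. a < y - k}" by auto
  then show ?thesis by (simp add: below_def card_image inj_on_def)
qed

lemma height_shifted: "height u (shifted k T) x z = int u - below (fst T) (x + k) + below (snd T) (z - k)"
  using below_shift[of "- k" "fst T" x] by (simp add: height_def shifted_def below_shift)

lemma shifted_shifted: "shifted k (shifted (- k) T) = T"
  by (simp add: shifted_def image_image)

lemma shifted_inj: "shifted k T = shifted k U \<Longrightarrow> T = U"
  using shifted_shifted[of "- k" T] shifted_shifted[of "- k" U] by simp

lemma card_shifted: "card (fst (shifted k T)) = card (fst T)" "card (snd (shifted k T)) = card (snd T)"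
  by (simp_all add: shifted_def card_image inj_on_def)

text \<open>In place of the region only its boundary \<open>g\<close> occurs, given on all integers, below which the first
start point and the first end point lie.\<close>
locale ladder_paths =
  fixes n :: nat and A E :: "nat \<Rightarrow> point" and g :: "int \<Rightarrow> int"
  assumes fst_A: "mono_on {1..n} (\<lambda>i. fst (A i))"
    and snd_A: "strict_antimono_on {1..n} (\<lambda>i. snd (A i))"
    and fst_E: "strict_mono_on {1..n} (\<lambda>i. fst (E i))"
    and snd_E: "antimono_on {1..n} (\<lambda>i. snd (E i))"
    and A_le_E: "i \<in> {1..n} \<Longrightarrow> fst (A i) \<le> fst (E i) \<and> snd (A i) \<le> snd (E i)"
    and g_mono: "x \<le> y \<Longrightarrow> g x \<le> g y"
    and g_start: "snd (A 1) < g x"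
    and g_end: "fst (E 1) \<le> x \<Longrightarrow> snd (E 1) < g x"
begin

lemma fst_A_le: "1 \<le> i \<Longrightarrow> i \<le> j \<Longrightarrow> j \<le> n \<Longrightarrow> fst (A i) \<le> fst (A j)"
  using fst_A by (auto simp: monotone_on_def)

lemma snd_E_le: "1 \<le> i \<Longrightarrow> i \<le> j \<Longrightarrow> j \<le> n \<Longrightarrow> snd (E j) \<le> snd (E i)"
  using snd_E by (auto simp: monotone_on_def)

lemma snd_A_le: "1 \<le> i \<Longrightarrow> i \<le> j \<Longrightarrow> j \<le> n \<Longrightarrow> snd (A j) + int j \<le> snd (A i) + int i"
proof (rotate_tac 1, induction j rule: dec_induct)
  case (step m)
  then have "snd (A (Suc m)) < snd (A m)" using snd_A by (auto simp: monotone_on_def)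
  with step show ?case by simp
qed simp

lemma fst_E_le: "1 \<le> i \<Longrightarrow> i \<le> j \<Longrightarrow> j \<le> n \<Longrightarrow> fst (E i) - int i \<le> fst (E j) - int j"
proof (rotate_tac 1, induction j rule: dec_induct)
  case (step m)
  then have "fst (E m) < fst (E (Suc m))" using fst_E by (auto simp: monotone_on_def)
  with step show ?case by simp
qed simp

sublocale ladder_rows n "\<lambda>u. fst (A (Suc u)) - int u" "\<lambda>u. snd (A (Suc u)) + int u + 1"
  "\<lambda>i. fst (E (Suc i)) - int i" "\<lambda>i. snd (E (Suc i)) + int i + 1" g
proof
  fix u v assume uv: "u \<le> v" "v < n"
  show "fst (A (Suc u)) - int u + int u \<le> fst (A (Suc v)) - int v + int v"
    using fst_A_le[of "Suc u" "Suc v"] uv by simp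
  show "snd (A (Suc v)) + int v + 1 \<le> snd (A (Suc u)) + int u + 1"
    using snd_A_le[of "Suc u" "Suc v"] uv by simp
  show "fst (E (Suc u)) - int u \<le> fst (E (Suc v)) - int v"
    using fst_E_le[of "Suc u" "Suc v"] uv by simp
  show "snd (E (Suc v)) + int v + 1 - int v \<le> snd (E (Suc u)) + int u + 1 - int u"
    using snd_E_le[of "Suc u" "Suc v"] uv by simp
next
  show "fst (A (Suc i)) - int i \<le> fst (E (Suc i)) - int i" if "i < n" for i
    using A_le_E[of "Suc i"] that by simp
  show "g x \<le> g y" if "x \<le> y" for x y using g_mono that .
  show "snd (A (Suc 0)) + int 0 + 1 \<le> g x" for x using g_start[of x] by simp
  show "snd (E (Suc 0)) + int 0 + 1 \<le> g x" if "fst (E (Suc 0)) - int 0 \<le> x" for x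
    using g_end[of x] that by simp
qed

definition paths :: "(nat \<Rightarrow> point list) set" where
  "paths = (\<Pi>\<^sub>E i\<in>{1..n}. lattice_paths (A i) (E i))"

definition family_rows :: "(nat \<Rightarrow> point list) \<Rightarrow> nat \<Rightarrow> rows" where
  "family_rows P = (\<lambda>i\<in>{0..<n}. shifted (int i) (turn_rows (P (Suc i))))"

definition families :: "(nat \<Rightarrow> point list) set" where
  "families = {P \<in> paths. (\<forall>i\<in>{1..n}. \<forall>(x, y)\<in>set (P i). y < g x) \<and>
     disjoint_family_on (\<lambda>i. set (P i)) {1..n}}"

abbreviation cols_left :: "(nat \<Rightarrow> point list) \<Rightarrow> nat \<Rightarrow> int \<Rightarrow> int" where
  "cols_left P i x \<equiv> below (fst (turn_rows (P i))) x"

abbreviation rows_under :: "(nat \<Rightarrow> point list) \<Rightarrow> nat \<Rightarrow> int \<Rightarrow> int" where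
  "rows_under P i y \<equiv> below (snd (turn_rows (P i))) y"

lemma pathsD: "P \<in> paths \<Longrightarrow> i \<in> {1..n} \<Longrightarrow> P i \<in> lattice_paths (A i) (E i)"
  by (auto simp: paths_def)

lemma finite_turn_rows:
  assumes "P \<in> paths" "i \<in> {1..n}"
  shows "finite (fst (turn_rows (P i)))" "finite (snd (turn_rows (P i)))"
  using lattice_path_rows(3)[OF pathsD[OF assms]] by (auto simp: turn_rows_def)

lemma in_path_iff:
  assumes "P \<in> paths" "i \<in> {1..n}"
  shows "(x, y) \<in> set (P i) \<longleftrightarrow> fst (A i) \<le> x \<and> x \<le> fst (E i) \<and> snd (A i) \<le> y \<and> y \<le> snd (E i) \<and>
     cols_left P i x \<le> rows_under P i (y + 1) \<and>
     (x = fst (E i) \<or> y = snd (A i) \<or> rows_under P i y < cols_left P i (x + 1))"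
  using lattice_path_rows(8)[OF pathsD[OF assms]] by (simp add: path_points_def)

lemma height_family_rows:
  assumes "i < n"
  shows "height i (family_rows P i) x z = int i - cols_left P (Suc i) (x + int i) + rows_under P (Suc i) (z - int i)"
  using assms by (simp add: family_rows_def height_shifted)

lemma family_rows_config:
  assumes "P \<in> paths"
  shows "config id (family_rows P)"
proof -
  have "family_rows P i \<in> arrays i i" if "i < n" for i
  proof -
    have i: "Suc i \<in> {1..n}" using that by simp
    note rows = lattice_path_rows[OF pathsD[OF assms i]]
    have "fst (shifted (int i) (turn_rows (P (Suc i)))) \<subseteq> {fst (A (Suc i)) - int i..<fst (E (Suc i)) - int i}"
      "snd (shifted (int i) (turn_rows (P (Suc i)))) \<subseteq> {snd (A (Suc i)) + int i + 1..<snd (E (Suc i)) + int i + 1}"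
      using rows(4,5) by (force simp: shifted_def)+
    then show ?thesis
      using that rows(6,7) by (simp add: arrays_def family_rows_def card_shifted)
  qed
  then show ?thesis by (simp add: config_def permutes_id)
qed

text \<open>Without the shift, a crossing is a point that is weakly above one path and weakly below
the next one, within the columns of the first of them and not below its start.\<close>
lemma crossing_family_rows:
  assumes "P \<in> paths"
  shows "crossing id (family_rows P) i (x - int i) (y + int i + 1) \<longleftrightarrow> Suc i < n \<and>
    fst (A (Suc i)) \<le> x \<and> x \<le> fst (E (Suc i)) \<and> snd (A (Suc i)) \<le> y \<and>
    cols_left P (Suc i) x \<le> rows_under P (Suc i) (y + 1) \<and>
    rows_under P (Suc (Suc i)) y < cols_left P (Suc (Suc i)) (x + 1)"
proof (cases "Suc i < n")
  case i: True
  then have ii: "Suc (Suc i) \<in> {1..n}" by simp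
  have A2: "snd (A (Suc (Suc i))) + int (Suc (Suc i)) \<le> snd (A (Suc i)) + int (Suc i)"
    using snd_A_le[of "Suc i" "Suc (Suc i)"] i by simp
  have "cols_left P (Suc (Suc i)) (x + 1) = 0" if "x < fst (A (Suc (Suc i)))"
    using lattice_path_rows(4)[OF pathsD[OF assms ii]] that by (intro below_eq_0) auto
  then have A1: "fst (A (Suc (Suc i))) \<le> x" if "rows_under P (Suc (Suc i)) y < cols_left P (Suc (Suc i)) (x + 1)"
    using that below_nonneg[of "snd (turn_rows (P (Suc (Suc i))))" y] by force
  have h1: "height (id i) (family_rows P i) (x - int i) (y + int i + 1) =
      int i - cols_left P (Suc i) x + rows_under P (Suc i) (y + 1)"
    using i by (simp add: height_family_rows algebra_simps)
  have h2: "height (id (Suc i)) (family_rows P (Suc i)) (x - int i) (y + int i + 1) =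
      int (Suc i) - cols_left P (Suc (Suc i)) (x + 1) + rows_under P (Suc (Suc i)) y"
    using i by (simp add: height_family_rows algebra_simps)
  show ?thesis
    unfolding crossing_def h1 h2 using i A2 A1 by auto
qed (simp add: crossing_def)

text \<open>At the last crossing both paths pass through the point, because it lies in the column of an NE-turn
of the upper path (or in its last column) and at the level of an NE-turn of the lower path.\<close>
lemma common_point_if_last_crossing:
  assumes P: "P \<in> paths" and last: "last_crossing id (family_rows P) i x z"
  shows "(x + int i, z - int i - 1) \<in> set (P (Suc i)) \<inter> set (P (Suc (Suc i)))"
proof -
  define X Y where "X = x + int i" and "Y = z - int i - 1"
  have cr: "crossing id (family_rows P) i (X - int i) (Y + int i + 1)"
    using last by (simp add: X_def Y_def last_crossing_def)
  then have i: "Suc i < n" by (simp add: crossing_def)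
  have mem: "Suc i \<in> {1..n}" "Suc (Suc i) \<in> {1..n}" using i by auto
  note cr' = cr[unfolded crossing_family_rows[OF P]]
  note ext = last_crossing_extremal[OF family_rows_config[OF P] last]
  note fin = finite_turn_rows[OF P mem(1)] finite_turn_rows[OF P mem(2)]
  note rows = lattice_path_rows[OF pathsD[OF P mem(2)]]
  have X: "X = fst (E (Suc i)) \<or> X \<in> fst (turn_rows (P (Suc i)))"
    using ext(1) i by (auto simp: X_def family_rows_def shifted_def)
  have Y: "Y \<in> snd (turn_rows (P (Suc (Suc i))))"
    using ext(2) i by (auto simp: Y_def family_rows_def shifted_def)
  have eq1: "cols_left P (Suc i) X = rows_under P (Suc i) (Y + 1)"
    using ext(3) i by (simp add: height_family_rows X_def Y_def)
  have eq2: "cols_left P (Suc (Suc i)) (X + 1) = rows_under P (Suc (Suc i)) Y + 1"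
    using ext(4) i by (simp add: height_family_rows X_def Y_def algebra_simps)
  have Y_bounds: "snd (A (Suc (Suc i))) < Y" "Y \<le> snd (E (Suc (Suc i)))"
    using rows(5) Y by auto
  have "(X, Y) \<in> set (P (Suc i))"
    using cr' X eq1 below_mono[OF fin(2), of Y "Y + 1"] below_plus_one[OF fin(1), of X] Y_bounds
      snd_E_le[of "Suc i" "Suc (Suc i)"] i
    by (auto simp: in_path_iff[OF P mem(1)])
  moreover have "cols_left P (Suc (Suc i)) (X + 1) = 0" if "X < fst (A (Suc (Suc i)))"
    using rows(4) that by (intro below_eq_0) auto
  then have "fst (A (Suc (Suc i))) \<le> X"
    using eq2 below_nonneg[of "snd (turn_rows (P (Suc (Suc i))))" Y] by force
  then have "(X, Y) \<in> set (P (Suc (Suc i)))"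
    using cr' eq2 below_mono[OF fin(3), of X "X + 1"] below_plus_one[OF fin(4), of Y] Y Y_bounds
      fst_E_le[of "Suc i" "Suc (Suc i)"] i
    by (auto simp: in_path_iff[OF P mem(2)])
  ultimately show ?thesis by (simp add: X_def Y_def)
qed

text \<open>A point weakly above a path is strictly above the next one, as it would be a crossing otherwise. The
bounds of \<open>crossing_family_rows\<close> continue to hold along the family by the order of the points
\<open>A\<close> and \<open>E\<close>.\<close>
lemma strictly_above_later_paths:
  assumes P: "P \<in> paths" and none: "\<And>i x z. \<not> crossing id (family_rows P) i x z"
    and "1 \<le> i" "i < j" "j \<le> n"
    and "fst (A j) \<le> x" "x \<le> fst (E i)" "snd (A i) \<le> y" "cols_left P i x \<le> rows_under P i (y + 1)"
  shows "cols_left P j (x + 1) \<le> rows_under P j y"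
proof -
  have strict: "cols_left P (Suc r) (x + 1) \<le> rows_under P (Suc r) y"
    if r: "i \<le> r" "r < j" "cols_left P r x \<le> rows_under P r (y + 1)" for r
  proof -
    obtain k where k: "r = Suc k" using assms(3) r by (cases r) auto
    have "fst (A r) \<le> x" using fst_A_le[of r j] assms r by simp
    moreover have "x \<le> fst (E r)" using fst_E_le[of i r] assms r by simp
    moreover have "snd (A r) \<le> y" using snd_A_le[of i r] assms r by simp
    ultimately show ?thesis
      using none[of k "x - int k" "y + int k + 1"] r assms(3-5)
      unfolding crossing_family_rows[OF P] k by auto
  qed
  have weak: "cols_left P r x \<le> rows_under P r (y + 1)" if "i \<le> r" "r < j" for r
    using that
  proof (induction r rule: dec_induct)
    case base
    then show ?case using assms by simp
  next
    case (step m)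
    then have "cols_left P (Suc m) (x + 1) \<le> rows_under P (Suc m) y" using strict[of m] by simp
    moreover have "Suc m \<in> {1..n}" using step assms by simp
    ultimately show ?case
      using below_mono[OF finite_turn_rows(1)[OF P], of "Suc m" x "x + 1"]
        below_mono[OF finite_turn_rows(2)[OF P], of "Suc m" y "y + 1"] by simp
  qed
  have "Suc (j - 1) = j" "i \<le> j - 1" "j - 1 < j" using assms by auto
  then show ?thesis using strict[of "j - 1"] weak[of "j - 1"] by simp
qed

lemma disjoint_iff_uncrossed:
  assumes P: "P \<in> paths"
  shows "disjoint_family_on (\<lambda>i. set (P i)) {1..n} \<longleftrightarrow> (\<forall>i x z. \<not> crossing id (family_rows P) i x z)"
proof
  assume disj: "disjoint_family_on (\<lambda>i. set (P i)) {1..n}"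
  show "\<forall>i x z. \<not> crossing id (family_rows P) i x z"
  proof (intro allI notI)
    fix i x z assume "crossing id (family_rows P) i x z"
    from last_crossing_exists[OF family_rows_config[OF P] this]
    obtain j y w where last: "last_crossing id (family_rows P) j y w" by blast
    then have "Suc j < n" by (simp add: last_crossing_def crossing_def)
    then have "set (P (Suc j)) \<inter> set (P (Suc (Suc j))) = {}"
      using disj by (intro disjoint_family_onD) auto
    with common_point_if_last_crossing[OF P last] show False by blast
  qed
next
  assume none: "\<forall>i x z. \<not> crossing id (family_rows P) i x z"
  have "set (P i) \<inter> set (P j) = {}" if ij: "1 \<le> i" "i < j" "j \<le> n" for i j
  proof (rule ccontr)
    assume "set (P i) \<inter> set (P j) \<noteq> {}"
    then obtain x y where xy: "(x, y) \<in> set (P i)" "(x, y) \<in> set (P j)" by auto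
    have mem: "i \<in> {1..n}" "j \<in> {1..n}" using ij by auto
    note i = xy(1)[unfolded in_path_iff[OF P mem(1)]] and j = xy(2)[unfolded in_path_iff[OF P mem(2)]]
    have "cols_left P j (x + 1) \<le> rows_under P j y"
      using i j ij none by (intro strictly_above_later_paths[OF P]) auto
    with i j fst_E_le[of i j] snd_A_le[of i j] ij show False by auto
  qed
  then show "disjoint_family_on (\<lambda>i. set (P i)) {1..n}"
    unfolding disjoint_family_on_def by (metis Int_commute atLeastAtMost_iff linorder_neqE_nat)
qed

text \<open>The NE-turn of the rank \<open>cols_left P 1 (x + 1)\<close> is the last one up to the column \<open>x\<close>, and it
lies below the boundary.\<close>
lemma in_ladder_if_in_region:
  assumes P: "P \<in> paths" and i: "0 < n" and region: "\<And>x y. (x, y) \<in> set (P 1) \<Longrightarrow> y < g x"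
  shows "in_ladder 0 (family_rows P 0)"
  unfolding in_ladder_def
proof
  fix x
  have mem: "1 \<in> {1..n}" using i by simp
  note fin = finite_turn_rows[OF P mem] and rows = lattice_path_rows[OF pathsD[OF P mem]]
  define m where "m = cols_left P 1 (x + 1)"
  have "m \<le> rows_under P 1 (g x)"
  proof (cases "m = 0")
    case True
    then show ?thesis by (simp add: below_nonneg)
  next
    case False
    then have m: "0 \<le> m - 1" "m - 1 < int (card (fst (turn_rows (P 1))))"
      using below_nonneg[of "fst (turn_rows (P 1))" "x + 1"] below_le_card[OF fin(1), of "x + 1"]
      by (auto simp: m_def)
    obtain c where c: "c \<in> fst (turn_rows (P 1))" "cols_left P 1 c = m - 1"
      using element_of_rank[OF fin(1) m] by blast
    obtain r where r: "r \<in> snd (turn_rows (P 1))" "rows_under P 1 r = m - 1"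
      using element_of_rank[OF fin(2), of "m - 1"] m rows(6,7) by metis
    have "c \<le> x" using below_mono[OF fin(1), of "x + 1" c] c(2) by (force simp: m_def)
    have "(c, r) \<in> set (P 1)"
      unfolding in_path_iff[OF P mem]
      using rows(4,5) c r below_plus_one[OF fin(1), of c] below_plus_one[OF fin(2), of r] by auto
    then have "r + 1 \<le> g x" using region[of c r] g_mono[OF \<open>c \<le> x\<close>] by simp
    then show ?thesis
      using below_mono[OF fin(2), of "r + 1" "g x"] r below_plus_one[OF fin(2), of r] by simp
  qed
  then show "0 \<le> height 0 (family_rows P 0) (x + 1) (g x)"
    using i by (simp add: height_family_rows m_def)
qed

text \<open>A point on or above the boundary is strictly above the first path, hence strictly above all
others, unless it is past the first end point. In the latter case all paths are too low to reach it.\<close>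
lemma in_region_if_in_ladder:
  assumes P: "P \<in> paths" and none: "\<And>i x z. \<not> crossing id (family_rows P) i x z"
    and lad: "in_ladder 0 (family_rows P 0)" and i: "i \<in> {1..n}" and xy: "(x, y) \<in> set (P i)"
  shows "y < g x"
proof (rule ccontr)
  assume "\<not> y < g x"
  then have y: "g x \<le> y" by simp
  have mem: "1 \<in> {1..n}" using i by simp
  note fin = finite_turn_rows[OF P mem]
  note pt = xy[unfolded in_path_iff[OF P i]]
  have x: "x < fst (E 1)"
    using g_end[of x] snd_E_le[of 1 i] i pt y by force
  have xi: "x < fst (E i)" using x fst_E_le[of 1 i] i by simp
  have A1: "snd (A i) < y" using g_start[of x] y snd_A_le[of 1 i] i by simp
  have "cols_left P 1 (x + 1) \<le> rows_under P 1 (g x)"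
    using lad mem by (simp add: in_ladder_def height_family_rows)
  then have ladder: "cols_left P 1 (x + 1) \<le> rows_under P 1 y"
    using below_mono[OF fin(2) y] by simp
  have "cols_left P i (x + 1) \<le> rows_under P i y"
  proof (cases "i = 1")
    case True
    with ladder show ?thesis by simp
  next
    case False
    have "cols_left P 1 x \<le> rows_under P 1 (y + 1)"
      using ladder below_mono[OF fin(1), of x "x + 1"] below_mono[OF fin(2), of y "y + 1"] by simp
    then show ?thesis
      using False i pt x g_start[of x] y by (intro strictly_above_later_paths[OF P none, of 1]) auto
  qed
  with pt xi A1 show False by simp
qed

text \<open>In a family without crossings, for the region as well as for the ladder condition only the first
member matters, and for this member the two conditions agree.\<close>
lemma families_iff:
  assumes P: "P \<in> paths" and n: "0 < n"
  shows "P \<in> families \<longleftrightarrow> family_rows P \<in> uncrossed"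
proof -
  note cfg = family_rows_config[OF P]
  have arr: "family_rows P i \<in> arrays i i" if "i < n" for i
    using cfg that by (simp add: config_def)
  have "family_rows P \<in> uncrossed \<longleftrightarrow>
      (\<forall>i<n. in_ladder i (family_rows P i)) \<and> (\<forall>i x z. \<not> crossing id (family_rows P) i x z)"
    using arr by (auto simp: uncrossed_def entry_def PiE_iff family_rows_def)
  also have "\<dots> \<longleftrightarrow> in_ladder 0 (family_rows P 0) \<and> (\<forall>i x z. \<not> crossing id (family_rows P) i x z)"
    using in_ladder_if_uncrossed[OF cfg] n by blast
  also have "\<dots> \<longleftrightarrow> (\<forall>i\<in>{1..n}. \<forall>(x, y)\<in>set (P i). y < g x) \<and>
      (\<forall>i x z. \<not> crossing id (family_rows P) i x z)"
    using in_ladder_if_in_region[OF P n] in_region_if_in_ladder[OF P] n by fastforce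
  finally show ?thesis
    using P disjoint_iff_uncrossed[OF P] by (simp add: families_def)
qed

lemma bij_family_rows:
  assumes n: "0 < n"
  shows "bij_betw family_rows families uncrossed"
proof (rule bij_betw_imageI)
  show "inj_on family_rows families"
  proof (rule inj_onI)
    fix P Q assume "P \<in> families" "Q \<in> families" and eq: "family_rows P = family_rows Q"
    then have PQ: "P \<in> paths" "Q \<in> paths" by (auto simp: families_def)
    show "P = Q"
    proof (rule PiE_ext)
      show "P \<in> (\<Pi>\<^sub>E i\<in>{1..n}. lattice_paths (A i) (E i))" "Q \<in> (\<Pi>\<^sub>E i\<in>{1..n}. lattice_paths (A i) (E i))"
        using PQ by (auto simp: paths_def)
      fix i assume i: "i \<in> {1..n}"
      then have "family_rows P (i - 1) = family_rows Q (i - 1)" "i - 1 < n" "Suc (i - 1) = i"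
        using eq by auto
      then have "turn_rows (P i) = turn_rows (Q i)"
        by (auto simp: family_rows_def dest: shifted_inj)
      then show "P i = Q i"
        using turn_rows_inj[of "A i" "E i"] pathsD[OF PQ(1) i] pathsD[OF PQ(2) i] by (auto dest: inj_onD)
    qed
  qed
  show "family_rows ` families = uncrossed"
  proof (intro equalityI subsetI)
    fix T assume "T \<in> family_rows ` families"
    then show "T \<in> uncrossed" using families_iff[OF _ n] by (auto simp: families_def)
  next
    fix T assume T: "T \<in> uncrossed"
    have "\<exists>p\<in>lattice_paths (A i) (E i). turn_rows p = shifted (- int (i - 1)) (T (i - 1))" if i: "i \<in> {1..n}" for i
    proof -
      obtain k where k: "i = Suc k" "k < n" using i by (cases i) auto
      have arr: "T k \<in> arrays k k"
        using T k by (auto simp: uncrossed_def entry_def PiE_iff)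
      let ?U = "shifted (- int k) (T k)"
      have "card (fst ?U) = card (snd ?U)"
        unfolding card_shifted using arr by (simp add: arrays_def)
      moreover have "fst ?U \<subseteq> {fst (A i)..<fst (E i)}" "snd ?U \<subseteq> {snd (A i)<..snd (E i)}"
        using arr unfolding k by (force simp: shifted_def arrays_def)+
      ultimately have "\<exists>p\<in>lattice_paths (A i) (E i). turn_rows p = (fst ?U, snd ?U)"
        using A_le_E[OF i] by (intro turn_rows_surj) auto
      then show ?thesis by (simp add: k)
    qed
    then obtain p where p: "\<And>i. i \<in> {1..n} \<Longrightarrow> p i \<in> lattice_paths (A i) (E i)"
      "\<And>i. i \<in> {1..n} \<Longrightarrow> turn_rows (p i) = shifted (- int (i - 1)) (T (i - 1))"
      by metis
    define P where "P = restrict p {1..n}"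
    have P: "P \<in> paths" using p(1) by (auto simp: P_def paths_def)
    have "family_rows P = T"
    proof (rule ext)
      fix i
      show "family_rows P i = T i"
        using T p(2)[of "Suc i"] shifted_shifted[of "int i" "T i"]
        by (auto simp: family_rows_def P_def uncrossed_def PiE_iff extensional_def)
    qed
    with T families_iff[OF P n] show "T \<in> family_rows ` families" by auto
  qed
qed

lemma rows_size_family_rows:
  assumes "P \<in> paths" "i < n"
  shows "rows_size (family_rows P i) = 2 * NE (P (Suc i))"
  using lattice_path_rows(6,7)[OF pathsD[OF assms(1)], of "Suc i"] assms(2)
  by (simp add: rows_size_def family_rows_def card_shifted)

end

lemma z_pow_sum: "z_pow (\<Sum>i\<in>I. q i) = (\<Prod>i\<in>I. z_pow (q i))"
  by (induction I rule: infinite_finite_induct) (auto simp: z_pow_0 z_pow_add)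

theorem theorem2:
  fixes n :: nat and a b :: int and f :: "int \<Rightarrow> int" and A E :: "nat \<Rightarrow> point"
  assumes "n > 0" and "a > 0" and "b > 0"
    and "f \<in> {0..a} \<rightarrow> {1..b + 1}" and "mono_on {0..a} f"
    and "\<And>x. x < 0 \<Longrightarrow> f x = f 0"
    and "\<And>i. i \<in> {1..n} \<Longrightarrow> A i \<in> ladder_region a f"
    and "\<And>i. i \<in> {1..n} \<Longrightarrow> E i \<in> ladder_region a f"
    and "\<And>x. x \<le> fst (A 1) \<Longrightarrow> f x = f (fst (A 1))"
    and "mono_on {1..n} (\<lambda>i. fst (A i))"
    and "strict_antimono_on {1..n} (\<lambda>i. snd (A i))"
    and "strict_mono_on {1..n} (\<lambda>i. fst (E i))"
    and "antimono_on {1..n} (\<lambda>i. snd (E i))"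
    and "\<And>i. i \<in> {1..n} \<Longrightarrow> fst (A i) \<le> fst (E i) \<and> snd (A i) \<le> snd (E i)"
  shows "(\<Sum>P\<in>nonintersecting_families n A E (ladder_region a f).
            z_pow (of_nat (NE_family n P))) =
         det (mat n n (\<lambda>(i, j). let s = i + 1; t = j + 1 in
            \<Sum>T\<in>TA (int t - int s)
                  (A t + (- int t + 1, int t)) (E s + (- int s, int s - 1)) f (int s - 1).
              z_pow (of_nat (array_size T) / 2)))"
proof -
  \<comment> \<open>The values of \<open>f\<close> to the right of \<open>a\<close> are arbitrary and are replaced to get a monotone function.\<close>
  define g where "g x = f (max 0 (min x a))" for x
  have f_neg: "f x = f 0" if "x \<le> 0" for x using assms(6)[of x] that by (cases "x = 0") auto
  have g_eq: "g x = f x" if "x \<le> a" for x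
    using f_neg[of x] that assms(2) by (cases "x \<le> 0") (auto simp: g_def)
  have g_mono: "g x \<le> g y" if "x \<le> y" for x y
    unfolding g_def using that assms(2) by (intro mono_onD[OF assms(5)]) auto
  have one: "1 \<in> {1..n}" using assms(1) by simp
  have A1: "0 \<le> fst (A 1)" "fst (A 1) \<le> a" "snd (A 1) < f (fst (A 1))"
    and E1: "fst (E 1) \<le> a" "snd (E 1) < f (fst (E 1))"
    using assms(7)[OF one] assms(8)[OF one] by (auto simp: ladder_region_def)
  interpret ladder_paths n A E g
  proof
    show "snd (A 1) < g x" for x
    proof (cases "x \<le> fst (A 1)")
      case True
      then show ?thesis using assms(9)[OF True] A1 g_eq[of x] by simp
    next
      case False
      then show ?thesis using g_mono[of "fst (A 1)" x] g_eq[of "fst (A 1)"] A1 by simp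
    qed
    show "snd (E 1) < g x" if "fst (E 1) \<le> x" for x
      using g_mono[OF that] g_eq[of "fst (E 1)"] E1 by simp
  qed (use assms g_mono in auto)
  let ?w = "\<lambda>k :: nat. z_pow (of_nat k / 2)"
  have entry: "(let s = i + 1; t = j + 1 in
      \<Sum>T\<in>TA (int t - int s) (A t + (- int t + 1, int t)) (E s + (- int s, int s - 1)) f (int s - 1).
        ?w (array_size T)) = (\<Sum>U\<in>entry j i. ?w (rows_size U))" if "i < n" for i j
  proof -
    have "Suc i \<in> {1..n}" using that by simp
    then have "fst (E (Suc i)) \<le> a" using assms(8) by (force simp: ladder_region_def)
    then have "f x = g x" if "x < fst (E (Suc i)) - int i" for x using g_eq[of x] that by simp
    note sum_TA[where w = ?w, OF this, of i j]
    moreover have "A (j + 1) + (- int (j + 1) + 1, int (j + 1)) =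
        (fst (A (Suc j)) - int j, snd (A (Suc j)) + int j + 1)"
      "E (i + 1) + (- int (i + 1), int (i + 1) - 1) =
        (fst (E (Suc i)) - int i - 1, snd (E (Suc i)) + int i + 1 - 1)"
      "int (j + 1) - int (i + 1) = int j - int i" "int (i + 1) - 1 = int i"
      by (simp_all add: prod_eq_iff)
    ultimately show ?thesis unfolding Let_def by simp
  qed
  have families: "nonintersecting_families n A E (ladder_region a f) = families"
  proof -
    have "(\<forall>i\<in>{1..n}. set (P i) \<subseteq> ladder_region a f) \<longleftrightarrow>
        (\<forall>i\<in>{1..n}. \<forall>(x, y)\<in>set (P i). y < g x)" if P: "P \<in> paths" for P
    proof -
      have "(x, y) \<in> ladder_region a f \<longleftrightarrow> y < g x" if i: "i \<in> {1..n}" and xy: "(x, y) \<in> set (P i)" for i x y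
      proof -
        have "0 \<le> fst (A i)" "0 \<le> snd (A i)" "fst (E i) \<le> a"
          using assms(7,8)[OF i] by (auto simp: ladder_region_def)
        then have "0 \<le> x" "0 \<le> y" "x \<le> a" using xy[unfolded in_path_iff[OF P i]] by auto
        then show ?thesis using g_eq[of x] by (simp add: ladder_region_def)
      qed
      then show ?thesis by fast
    qed
    then show ?thesis
      unfolding nonintersecting_families_def families_def paths_def by blast
  qed
  have w_mult: "?w (rows_size T) * ?w (rows_size U) = ?w (rows_size T') * ?w (rows_size U')"
    if "rows_size T + rows_size U = rows_size T' + rows_size U'" for T U T' U'
  proof -
    have "rat_of_nat (rows_size T + rows_size U) = of_nat (rows_size T' + rows_size U')" using that by simp
    then show ?thesis by (simp flip: z_pow_add add_divide_distrib)
  qed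
  have "det (mat n n (\<lambda>(i, j). let s = i + 1; t = j + 1 in
      \<Sum>T\<in>TA (int t - int s) (A t + (- int t + 1, int t)) (E s + (- int s, int s - 1)) f (int s - 1).
        ?w (array_size T))) = det (mat n n (\<lambda>(i, j). \<Sum>U\<in>entry j i. ?w (rows_size U)))"
    by (intro arg_cong[where f = det] cong_mat) (simp_all only: prod.case entry)
  also have "\<dots> = (\<Sum>T\<in>uncrossed. \<Prod>i\<in>{0..<n}. ?w (rows_size (T i)))"
    by (rule det_entries[OF w_mult])
  also have "\<dots> = (\<Sum>P\<in>families. \<Prod>i\<in>{0..<n}. ?w (rows_size (family_rows P i)))"
    by (rule sum.reindex_bij_betw[OF bij_family_rows[OF assms(1)], symmetric])
  also have "\<dots> = (\<Sum>P\<in>families. z_pow (of_nat (NE_family n P)))"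
  proof (rule sum.cong[OF refl])
    fix P assume "P \<in> families"
    then have P: "P \<in> paths" by (simp add: families_def)
    have "NE_family n P = (\<Sum>i\<in>{0..<n}. NE (P (Suc i)))"
      unfolding NE_family_def by (rule sum.reindex_bij_witness[of _ Suc "\<lambda>i. i - 1"]) auto
    then show "(\<Prod>i\<in>{0..<n}. ?w (rows_size (family_rows P i))) = z_pow (of_nat (NE_family n P))"
      by (simp add: rows_size_family_rows[OF P] z_pow_sum)
  qed
  finally show ?thesis by (simp only: families)
qed

end
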